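(* Let $G=(V,E)$ be a finite, simple, connected, undirected, unweighted, non-bipartite graph with $n$ vertices, and let $h_u^{(l)}$ ($u\in V$, $l\ge 0$) be the node features computed by a graph neural network on $G$ from initial node features $(x_v)_{v\in V}$ with differentiable update functions $\phi_l,\psi_l$ (as defined in the context). Let $r\in\mathbb{N}$. Assume that $\|\nabla\phi_l\|\le\alpha$ and $\max\{\|\nabla\psi_l\|,1\}\le\beta$ for all layers $l$. Let $d_{\min}=\min_{v\in V}d_v$ and $d_{\max}=\max_{v\in V}d_v$. Let $\mu_n\le\cdots\le\mu_2<\mu_1=1$ be the eigenvalues of the normalized adjacency matrix $\hat A$, and let $\mu<1$ satisfy $\max\{|\mu_2|,|\mu_n|\}\le\mu$. Then $$\sum_{u\ne v\in V}\left\|\frac{\partial h_u^{(r)}}{\partial x_v}\right\|\le(2\alpha\beta)^r\,\frac{d_{\max}}{2}\left(\frac{n(n-1)}{d_{\min}}\left(r+1+\frac{\mu^{r+1}}{1-\mu}\right)-R_{\mathrm{tot}}\right),$$ where the sum on the left is over unordered pairs of distinct vertices, each pair $\{u,v\}$ contributing one term, with an arbitrary choice of which of its two vertices plays the role of $u$ and which that of $v$.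
   Context: $A$ is the adjacency matrix of $G$, $D$ the diagonal degree matrix, $d_v$ the degree of the vertex $v$, $L=D-A$ the Laplacian, $\hat A=D^{-1/2}AD^{-1/2}$ the normalized adjacency matrix. $L^{+}$ denotes the Moore–Penrose pseudoinverse of $L$, and $1_v\in\mathbb{R}^V$ is the indicator vector of $v$. The effective resistance between $u$ and $v$ is $R_{u,v}=(1_u-1_v)^TL^{+}(1_u-1_v)$. The total effective resistance $R_{\mathrm{tot}}$ is the sum of $R_{u,v}$ over all unordered pairs $\{u,v\}$ of distinct vertices. Graph neural network: each vertex $v$ has an initial feature vector $x_v\in\mathbb{R}^d$; set $h_v^{(0)}=x_v$ and, for $l\ge0$, $$h_v^{(l+1)}=\phi_l\Big(h_v^{(l)},\ \sum_{u\in\mathcal N(v)}\hat A_{uv}\,\psi_l\big(h_u^{(l)}\big)\Big),$$ where $\mathcal N(v)$ is the set of neighbors of $v$ and $\phi_l,\psi_l$ are differentiable functions between Euclidean spaces of compatible dimensions. $\nabla f$ denotes the Jacobian matrix of a map $f$ (for $\phi_l$, the Jacobian with respect to both arguments jointly). $\partial h_u^{(r)}/\partial x_v$ is the Jacobian matrix of $h_u^{(r)}$ with respect to the initial feature vector $x_v$. $\|\cdot\|$ is the matrix 2-norm (operator norm induced by the Euclidean norm); bounds such as $\|\nabla\phi_l\|\le\alpha$ are meant at every point. *)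

theory Defs
  imports "HOL-Analysis.Analysis" "Jordan_Normal_Form.Matrix"
begin

text \<open>
  Graphs are adjacency predicates on a finite vertex type, so graph matrices are the
  type-indexed matrices of \<^theory>\<open>HOL-Analysis.Finite_Cartesian_Product\<close>. The dimensions of the
  feature spaces vary with the layer, so features and Jacobians use the vectors and matrices of
  \<^theory>\<open>Jordan_Normal_Form.Matrix\<close>, where the Euclidean space of dimension \<open>m\<close> is \<open>carrier_vec m\<close>.
\<close>

no_notation vec_index (infixl \<open>$\<close> 100)
notation vec_index (infixl \<open>$v\<close> 100)


section \<open>Graphs and their matrices\<close>

definition simple_graph :: "('v \<Rightarrow> 'v \<Rightarrow> bool) \<Rightarrow> bool" where
  "simple_graph E \<longleftrightarrow> symp E \<and> irreflp E"

definition connected_graph :: "('v \<Rightarrow> 'v \<Rightarrow> bool) \<Rightarrow> bool" where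
  "connected_graph E \<longleftrightarrow> (\<forall>u v. E\<^sup>*\<^sup>* u v)"

definition bipartite :: "('v \<Rightarrow> 'v \<Rightarrow> bool) \<Rightarrow> bool" where
  "bipartite E \<longleftrightarrow> (\<exists>S. \<forall>u v. E u v \<longrightarrow> (u \<in> S) \<noteq> (v \<in> S))"

definition neighbors :: "('v \<Rightarrow> 'v \<Rightarrow> bool) \<Rightarrow> 'v \<Rightarrow> 'v set" where
  "neighbors E v = {u. E v u}"

definition vertex_degree :: "('v \<Rightarrow> 'v \<Rightarrow> bool) \<Rightarrow> 'v \<Rightarrow> nat" where
  "vertex_degree E v = card (neighbors E v)"

definition min_degree :: "('v::finite \<Rightarrow> 'v \<Rightarrow> bool) \<Rightarrow> nat" where
  "min_degree E = Min (range (vertex_degree E))"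

definition max_degree :: "('v::finite \<Rightarrow> 'v \<Rightarrow> bool) \<Rightarrow> nat" where
  "max_degree E = Max (range (vertex_degree E))"

definition diag_matrix :: "('v \<Rightarrow> real) \<Rightarrow> real^'v^'v" where
  "diag_matrix f = (\<chi> i j. if i = j then f i else 0)"

definition adjacency :: "('v \<Rightarrow> 'v \<Rightarrow> bool) \<Rightarrow> real^'v^'v" where
  "adjacency E = (\<chi> u v. if E u v then 1 else 0)"

definition laplacian :: "('v \<Rightarrow> 'v \<Rightarrow> bool) \<Rightarrow> real^'v^'v" where
  "laplacian E = diag_matrix (\<lambda>v. real (vertex_degree E v)) - adjacency E"

definition normalized_adjacency :: "('v::finite \<Rightarrow> 'v \<Rightarrow> bool) \<Rightarrow> real^'v^'v" where
  "normalized_adjacency E =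
     diag_matrix (\<lambda>v. 1 / sqrt (real (vertex_degree E v))) ** adjacency E **
     diag_matrix (\<lambda>v. 1 / sqrt (real (vertex_degree E v)))"

text \<open>The Moore--Penrose pseudoinverse, characterized by the four Penrose equations.\<close>

definition pseudoinverse :: "real^'n::finite^'m::finite \<Rightarrow> real^'m^'n" where
  "pseudoinverse M = (THE X. M ** X ** M = M \<and> X ** M ** X = X \<and>
     transpose (M ** X) = M ** X \<and> transpose (X ** M) = X ** M)"

definition effective_resistance :: "('v::finite \<Rightarrow> 'v \<Rightarrow> bool) \<Rightarrow> 'v \<Rightarrow> 'v \<Rightarrow> real" where
  "effective_resistance E u v =
     inner (axis u 1 - axis v 1) (pseudoinverse (laplacian E) *v (axis u 1 - axis v 1))"

text \<open>The factor 1/2 turns the sum over ordered pairs into the one over unordered pairs,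
  since \<^const>\<open>effective_resistance\<close> is symmetric in the two vertices.\<close>

definition total_resistance :: "('v::finite \<Rightarrow> 'v \<Rightarrow> bool) \<Rightarrow> real" where
  "total_resistance E = (\<Sum>(u, v) \<in> {(u, v). u \<noteq> v}. effective_resistance E u v) / 2"

text \<open>\<open>mu 1 \<ge> mu 2 \<ge> \<dots> \<ge> mu n\<close> lists the roots of the characteristic polynomial of \<open>M\<close> with
  multiplicity; the values of \<open>mu\<close> outside \<open>{1..n}\<close> are irrelevant.\<close>

definition ordered_eigenvalues :: "real^'n::finite^'n \<Rightarrow> (nat \<Rightarrow> real) \<Rightarrow> bool" where
  "ordered_eigenvalues M mu \<longleftrightarrow>
     (\<forall>x. det (Finite_Cartesian_Product.mat x - M) = (\<Prod>i = 1..CARD('n). x - mu i)) \<and>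
     antimono_on {1..CARD('n)} mu"


section \<open>Differentiation between Euclidean spaces of arbitrary dimension\<close>

definition euclid_norm :: "real vec \<Rightarrow> real" where
  "euclid_norm x = L2_set (\<lambda>i. x $v i) {..<dim_vec x}"

text \<open>Operator norm induced by the Euclidean norms. Taking the unit ball rather than the sphere
  gives the value 0 also when there are no columns.\<close>

definition operator_norm :: "real mat \<Rightarrow> real" where
  "operator_norm M =
     (SUP x \<in> {x \<in> carrier_vec (dim_col M). euclid_norm x \<le> 1}. euclid_norm (M *\<^sub>v x))"

text \<open>\<open>f\<close> maps the Euclidean space of dimension \<open>m\<close> to that of dimension \<open>k\<close> and is (Frechet)
  differentiable at every point.\<close>

definition differentiable_map :: "nat \<Rightarrow> nat \<Rightarrow> (real vec \<Rightarrow> real vec) \<Rightarrow> bool" where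
  "differentiable_map m k f \<longleftrightarrow> f \<in> carrier_vec m \<rightarrow> carrier_vec k \<and>
     (\<forall>x \<in> carrier_vec m. \<exists>J \<in> carrier_mat k m. \<forall>e > 0. \<exists>d > 0. \<forall>y \<in> carrier_vec m.
        euclid_norm (y - x) < d \<longrightarrow>
        euclid_norm (f y - f x - J *\<^sub>v (y - x)) \<le> e * euclid_norm (y - x))"

text \<open>The matrix of partial derivatives of \<open>f\<close> at \<open>x\<close>.\<close>

definition jacobian_mat :: "(real vec \<Rightarrow> real vec) \<Rightarrow> real vec \<Rightarrow> real mat" where
  "jacobian_mat f x = Matrix.mat (dim_vec (f x)) (dim_vec x)
     (\<lambda>(i, j). deriv (\<lambda>t. f (x + t \<cdot>\<^sub>v unit_vec (dim_vec x) j) $v i) 0)"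

text \<open>A map of two arguments, of dimensions \<open>a\<close> and \<open>b\<close>, as a map on the product space,
  that is, on vectors of dimension \<open>a + b\<close>.\<close>

definition joint :: "nat \<Rightarrow> nat \<Rightarrow> (real vec \<Rightarrow> real vec \<Rightarrow> real vec) \<Rightarrow> real vec \<Rightarrow> real vec" where
  "joint a b f z = f (vec_first z a) (vec_last z b)"


section \<open>Graph neural networks\<close>

text \<open>Layer \<open>l\<close> has features of dimension \<open>fdim l\<close> and messages of dimension \<open>mdim l\<close>.\<close>

definition gnn_maps ::
  "(nat \<Rightarrow> nat) \<Rightarrow> (nat \<Rightarrow> nat) \<Rightarrow> (nat \<Rightarrow> real vec \<Rightarrow> real vec \<Rightarrow> real vec) \<Rightarrow>
   (nat \<Rightarrow> real vec \<Rightarrow> real vec) \<Rightarrow> bool" where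
  "gnn_maps fdim mdim \<phi> \<psi> \<longleftrightarrow> (\<forall>l.
     differentiable_map (fdim l + mdim l) (fdim (Suc l)) (joint (fdim l) (mdim l) (\<phi> l)) \<and>
     differentiable_map (fdim l) (mdim l) (\<psi> l))"

primrec gnn_feature ::
  "('v::finite \<Rightarrow> 'v \<Rightarrow> bool) \<Rightarrow> (nat \<Rightarrow> nat) \<Rightarrow> (nat \<Rightarrow> real vec \<Rightarrow> real vec \<Rightarrow> real vec) \<Rightarrow>
   (nat \<Rightarrow> real vec \<Rightarrow> real vec) \<Rightarrow> ('v \<Rightarrow> real vec) \<Rightarrow> nat \<Rightarrow> 'v \<Rightarrow> real vec" where
  "gnn_feature E mdim \<phi> \<psi> x 0 v = x v"
| "gnn_feature E mdim \<phi> \<psi> x (Suc l) v =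
     \<phi> l (gnn_feature E mdim \<phi> \<psi> x l v)
       (finsum_vec TYPE(real) (mdim l)
         (\<lambda>u. (normalized_adjacency E $ u $ v) \<cdot>\<^sub>v \<psi> l (gnn_feature E mdim \<phi> \<psi> x l u))
         (neighbors E v))"

text \<open>The Jacobian of the feature of \<open>u\<close> at layer \<open>r\<close> with respect to the initial feature of \<open>v\<close>,
  all other initial features being held fixed.\<close>

definition feature_jacobian ::
  "('v::finite \<Rightarrow> 'v \<Rightarrow> bool) \<Rightarrow> (nat \<Rightarrow> nat) \<Rightarrow> (nat \<Rightarrow> real vec \<Rightarrow> real vec \<Rightarrow> real vec) \<Rightarrow>
   (nat \<Rightarrow> real vec \<Rightarrow> real vec) \<Rightarrow> ('v \<Rightarrow> real vec) \<Rightarrow> nat \<Rightarrow> 'v \<Rightarrow> 'v \<Rightarrow> real mat" where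
  "feature_jacobian E mdim \<phi> \<psi> x r u v =
     jacobian_mat (\<lambda>z. gnn_feature E mdim \<phi> \<psi> (x(v := z)) r u) (x v)"

end

theory Submission
  imports Defs
begin

text \<open>
  Write \<open>A\<close> for the normalized adjacency matrix, \<open>D\<close> for the degree matrix and
  \<open>S = I + A + \<dots> + A^r\<close>. By the chain rule, the norms of the Jacobians of the features with respect
  to \<open>x v\<close> are multiplied in each layer by at most \<open>\<alpha> \<beta> (I + A)\<close>, entrywise; hence the Jacobian of the
  feature of \<open>u\<close> at layer \<open>r\<close> has norm at most \<open>(2 \<alpha> \<beta>)^r S\<^sub>u\<^sub>v\<close>.
  On the other hand \<open>L = D^(1/2) (I - A) D^(1/2)\<close>. So with \<open>b = D^(-1/2) (1\<^sub>u - 1\<^sub>v)\<close> and the solution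
  \<open>z\<close> of \<open>(I - A) z = b\<close> orthogonal to \<open>D^(1/2) 1\<close>, the effective resistance is
  \<open>b \<bullet> z = b \<bullet> S b + b \<bullet> A^(r+1) z\<close>. The spectral gap controls the last term, the diagonal entries of
  \<open>S\<close> are at most \<open>r + 1\<close>, and its off-diagonal entries contribute \<open>- 2 S\<^sub>u\<^sub>v / sqrt (d u * d v)\<close>
  to \<open>b \<bullet> S b\<close>.
\<close>

section \<open>Derivatives with norm bounds\<close>

lemma euclid_norm_nonneg: "0 \<le> euclid_norm a"
  by (simp add: euclid_norm_def)

lemma euclid_norm_add_le:
  assumes "dim_vec a = dim_vec b"
  shows "euclid_norm (a + b) \<le> euclid_norm a + euclid_norm b"
proof -
  have "euclid_norm (a + b) = L2_set (\<lambda>i. a $v i + b $v i) {..<dim_vec b}"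
    unfolding euclid_norm_def by (rule L2_set_cong) auto
  then show ?thesis
    using L2_set_triangle_ineq[of "vec_index a" "vec_index b"] assms by (simp add: euclid_norm_def)
qed

lemma euclid_norm_smult: "euclid_norm (c \<cdot>\<^sub>v a) = \<bar>c\<bar> * euclid_norm a"
proof -
  have "euclid_norm (c \<cdot>\<^sub>v a) = L2_set (\<lambda>i. \<bar>c\<bar> * a $v i) {..<dim_vec a}"
    unfolding euclid_norm_def L2_set_def by (simp add: power_mult_distrib)
  then show ?thesis by (simp add: euclid_norm_def L2_set_right_distrib)
qed

lemma euclid_norm_append_le: "euclid_norm (a @\<^sub>v b) \<le> euclid_norm a + euclid_norm b"
proof -
  have "(\<Sum>i<dim_vec a + dim_vec b. ((a @\<^sub>v b) $v i)\<^sup>2)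
      = (\<Sum>i<dim_vec a. (a $v i)\<^sup>2) + (\<Sum>i<dim_vec b. (b $v i)\<^sup>2)"
    unfolding lessThan_atLeast0
      sum.atLeastLessThan_concat[of 0 "dim_vec a" "dim_vec a + dim_vec b", symmetric, simplified]
    using sum.shift_bounds_nat_ivl[of "\<lambda>i. ((a @\<^sub>v b) $v i)\<^sup>2" 0 "dim_vec a" "dim_vec b"]
    by (simp add: add.commute)
  then show ?thesis
    by (simp add: euclid_norm_def L2_set_def sqrt_add_le_add_sqrt sum_nonneg)
qed

lemma abs_index_le_euclid_norm: "i < dim_vec a \<Longrightarrow> \<bar>a $v i\<bar> \<le> euclid_norm a"
  unfolding euclid_norm_def using member_le_L2_set[of "{..<dim_vec a}" i "\<lambda>i. \<bar>a $v i\<bar>"]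
  by (simp add: L2_set_def)

lemma euclid_norm_zero: "euclid_norm (0\<^sub>v n) = 0"
  by (simp add: euclid_norm_def L2_set_def)

lemma euclid_norm_eq_0: "euclid_norm a = 0 \<Longrightarrow> a = 0\<^sub>v (dim_vec a)"
  using abs_index_le_euclid_norm by (intro eq_vecI) fastforce+

text \<open>The constant is the crude sum of all absolute entries. Its size is irrelevant: it shows
  that the supremum in \<open>operator_norm\<close> ranges over a bounded set, without which that
  supremum carries no information.\<close>

lemma mult_mat_vec_bounded:
  fixes M :: "real mat"
  obtains C where "0 \<le> C"
    and "\<And>y. y \<in> carrier_vec (dim_col M) \<Longrightarrow> euclid_norm (M *\<^sub>v y) \<le> C * euclid_norm y"
proof
  let ?C = "\<Sum>i<dim_row M. \<Sum>j<dim_col M. \<bar>M $$ (i, j)\<bar>"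
  show "0 \<le> ?C" by (intro sum_nonneg) auto
  fix y :: "real vec" assume y: "y \<in> carrier_vec (dim_col M)"
  have "\<bar>(M *\<^sub>v y) $v i\<bar> \<le> (\<Sum>j<dim_col M. \<bar>M $$ (i, j)\<bar>) * euclid_norm y" if "i < dim_row M" for i
  proof -
    have "(M *\<^sub>v y) $v i = (\<Sum>j<dim_col M. M $$ (i, j) * y $v j)"
      using that y by (auto simp: scalar_prod_def lessThan_atLeast0)
    also have "\<bar>\<dots>\<bar> \<le> (\<Sum>j<dim_col M. \<bar>M $$ (i, j)\<bar> * euclid_norm y)"
      using y by (intro order_trans[OF sum_abs] sum_mono)
        (auto simp: abs_mult intro!: mult_left_mono abs_index_le_euclid_norm)
    finally show ?thesis by (simp add: sum_distrib_right)
  qed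
  then have "(\<Sum>i<dim_row M. \<bar>(M *\<^sub>v y) $v i\<bar>) \<le> ?C * euclid_norm y"
    unfolding sum_distrib_right[of _ "{..<dim_row M}"] by (intro sum_mono) simp
  then show "euclid_norm (M *\<^sub>v y) \<le> ?C * euclid_norm y"
    using L2_set_le_sum_abs[of "vec_index (M *\<^sub>v y)" "{..<dim_row M}"]
    by (simp add: euclid_norm_def[of "M *\<^sub>v y"])
qed

lemma operator_norm_bdd_above:
  "bdd_above ((\<lambda>x. euclid_norm (M *\<^sub>v x)) ` {x \<in> carrier_vec (dim_col M). euclid_norm x \<le> 1})"
proof -
  obtain C where C: "0 \<le> C"
    "\<And>y. y \<in> carrier_vec (dim_col M) \<Longrightarrow> euclid_norm (M *\<^sub>v y) \<le> C * euclid_norm y"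
    using mult_mat_vec_bounded[of M] by metis
  have "euclid_norm (M *\<^sub>v y) \<le> C" if "y \<in> carrier_vec (dim_col M)" "euclid_norm y \<le> 1" for y
    using C(2)[OF that(1)] mult_left_mono[OF that(2) C(1)] by simp
  then show ?thesis by (intro bdd_aboveI2[where M = C]) auto
qed

lemma operator_norm_nonneg: "0 \<le> operator_norm M"
proof -
  have "euclid_norm (M *\<^sub>v 0\<^sub>v (dim_col M)) \<le> operator_norm M"
    unfolding operator_norm_def
    by (rule cSUP_upper[OF _ operator_norm_bdd_above]) (auto simp: euclid_norm_zero)
  then show ?thesis using euclid_norm_nonneg order_trans by blast
qed

lemma euclid_norm_mult_mat_vec_le:
  assumes "x \<in> carrier_vec (dim_col M)"
  shows "euclid_norm (M *\<^sub>v x) \<le> operator_norm M * euclid_norm x"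
proof (cases "euclid_norm x = 0")
  case True
  then have x: "x = 0\<^sub>v (dim_col M)" using euclid_norm_eq_0[of x] assms by auto
  have "M *\<^sub>v x = 0\<^sub>v (dim_row M)" unfolding x by (intro eq_vecI) auto
  then show ?thesis using True by (simp add: euclid_norm_zero)
next
  case False
  then have pos: "0 < euclid_norm x" using euclid_norm_nonneg[of x] by simp
  let ?y = "(1 / euclid_norm x) \<cdot>\<^sub>v x"
  have "euclid_norm (M *\<^sub>v ?y) \<le> operator_norm M"
    unfolding operator_norm_def
    using pos assms by (intro cSUP_upper[OF _ operator_norm_bdd_above]) (auto simp: euclid_norm_smult)
  moreover have "M *\<^sub>v ?y = (1 / euclid_norm x) \<cdot>\<^sub>v (M *\<^sub>v x)"
    using assms by (intro mult_mat_vec[of _ "dim_row M" "dim_col M"]) auto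
  ultimately show ?thesis using pos by (simp add: euclid_norm_smult field_simps)
qed

lemma operator_norm_le:
  assumes "0 \<le> c"
    and "\<And>y. y \<in> carrier_vec (dim_col M) \<Longrightarrow> euclid_norm (M *\<^sub>v y) \<le> c * euclid_norm y"
  shows "operator_norm M \<le> c"
  unfolding operator_norm_def
proof (rule cSUP_least)
  show "{x \<in> carrier_vec (dim_col M). euclid_norm x \<le> 1} \<noteq> {}"
    using euclid_norm_zero[of "dim_col M"] by (metis (mono_tags, lifting) empty_iff mem_Collect_eq zero_carrier_vec zero_le_one)
  fix y assume "y \<in> {x \<in> carrier_vec (dim_col M). euclid_norm x \<le> 1}"
  then show "euclid_norm (M *\<^sub>v y) \<le> c"
    using assms(2)[of y] mult_left_mono[of "euclid_norm y" 1 c] assms(1) by auto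
qed

section \<open>Frechet derivatives at a point and the matrix of partial derivatives\<close>

text \<open>The pointwise content of \<open>differentiable_map\<close>, with the derivative as an
  explicit argument. The carriers are part of the predicate, so dimensions can be recovered from
  it.\<close>

definition has_jacobian ::
  "nat \<Rightarrow> nat \<Rightarrow> (real vec \<Rightarrow> real vec) \<Rightarrow> real vec \<Rightarrow> real mat \<Rightarrow> bool" where
  "has_jacobian m k f x J \<longleftrightarrow> f \<in> carrier_vec m \<rightarrow> carrier_vec k \<and> x \<in> carrier_vec m \<and>
     J \<in> carrier_mat k m \<and> (\<forall>e > 0. \<exists>d > 0. \<forall>y \<in> carrier_vec m.
        euclid_norm (y - x) < d \<longrightarrow>
        euclid_norm (f y - f x - J *\<^sub>v (y - x)) \<le> e * euclid_norm (y - x))"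

text \<open>The derivative is hidden because only its bound is passed from layer to layer. Stating
  the bound on vectors keeps suprema out of the calculus rules. For \<open>m = 0\<close> the
  inequality alone would admit negative \<open>c\<close>, hence the separate conjunct.\<close>

definition diff_bounded ::
  "nat \<Rightarrow> nat \<Rightarrow> (real vec \<Rightarrow> real vec) \<Rightarrow> real vec \<Rightarrow> real \<Rightarrow> bool" where
  "diff_bounded m k f x c \<longleftrightarrow> 0 \<le> c \<and> (\<exists>J. has_jacobian m k f x J \<and>
     (\<forall>y \<in> carrier_vec m. euclid_norm (J *\<^sub>v y) \<le> c * euclid_norm y))"

lemma has_jacobianD:
  assumes "has_jacobian m k f x J"
  shows "f \<in> carrier_vec m \<rightarrow> carrier_vec k" "x \<in> carrier_vec m" "J \<in> carrier_mat k m"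
  using assms by (auto simp: has_jacobian_def)

text \<open>Along the line through \<open>x\<close> in the direction of the \<open>j\<close>-th unit
  vector, the increment has length \<open>\<bar>h\<bar>\<close>, so the Frechet estimate becomes an
  estimate for the difference quotient of each component. In particular the derivative is
  unique.\<close>

lemma has_jacobian_imp_jacobian_mat:
  assumes J: "has_jacobian m k f x J"
  shows "jacobian_mat f x = J"
proof (rule eq_matI)
  note D = has_jacobianD[OF J]
  have dims: "dim_vec x = m" "dim_vec (f x) = k" "dim_row J = k" "dim_col J = m"
    using D by (auto simp: Pi_iff)
  fix i j assume "i < dim_row J" "j < dim_col J"
  then have ij: "i < k" "j < m" by (simp_all add: dims)
  define F where "F = (\<lambda>t. f (x + t \<cdot>\<^sub>v unit_vec m j) $v i)"
  have "(F has_field_derivative J $$ (i, j)) (at 0)"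
    unfolding DERIV_def Lim_at
  proof (intro allI impI)
    fix e :: real assume e: "0 < e"
    \<comment> \<open>Halving \<open>e\<close> turns the weak inequality of
      \<open>has_jacobian\<close> into the strict one in the definition of a limit.\<close>
    then obtain d where d: "0 < d" "\<And>y. y \<in> carrier_vec m \<Longrightarrow> euclid_norm (y - x) < d \<Longrightarrow>
        euclid_norm (f y - f x - J *\<^sub>v (y - x)) \<le> e / 2 * euclid_norm (y - x)"
      using J unfolding has_jacobian_def by (meson half_gt_zero)
    have "dist ((F (0 + h) - F 0) / h) (J $$ (i, j)) < e" if h: "0 < dist h 0" "dist h 0 < d" for h
    proof -
      let ?y = "x + h \<cdot>\<^sub>v unit_vec m j"
      have y: "?y \<in> carrier_vec m" using D by auto
      have yx: "?y - x = h \<cdot>\<^sub>v unit_vec m j" using D by auto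
      have "euclid_norm (unit_vec m j) = 1"
        using ij by (simp add: euclid_norm_def L2_set_def if_distrib[of "\<lambda>z. z\<^sup>2"] cong: if_cong)
      then have n: "euclid_norm (?y - x) = \<bar>h\<bar>" by (simp add: yx euclid_norm_smult)
      have x0: "x + 0 \<cdot>\<^sub>v unit_vec m j = x" using D by (intro eq_vecI) auto
      have fy: "f ?y \<in> carrier_vec k" "f x \<in> carrier_vec k" using D y by blast+
      have "J *\<^sub>v (h \<cdot>\<^sub>v unit_vec m j) = h \<cdot>\<^sub>v (J *\<^sub>v unit_vec m j)"
        using D by (intro mult_mat_vec) auto
      then have "(f ?y - f x - J *\<^sub>v (?y - x)) $v i = F h - F 0 - h * J $$ (i, j)"
        using ij D fy by (simp add: yx F_def x0)
      moreover have "\<bar>(f ?y - f x - J *\<^sub>v (?y - x)) $v i\<bar> \<le> e / 2 * \<bar>h\<bar>"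
        using d(2)[OF y] h n D ij
        by (intro order_trans[OF abs_index_le_euclid_norm]) (auto simp: yx)
      ultimately have "\<bar>F h - F 0 - h * J $$ (i, j)\<bar> \<le> e / 2 * \<bar>h\<bar>" by simp
      moreover have "(F h - F 0) / h - J $$ (i, j) = (F h - F 0 - h * J $$ (i, j)) / h"
        using h by (simp add: field_simps)
      ultimately have "\<bar>(F h - F 0) / h - J $$ (i, j)\<bar> \<le> e / 2"
        using h by (simp add: abs_divide divide_le_eq)
      then show ?thesis using e by (simp add: dist_real_def)
    qed
    then show "\<exists>d>0. \<forall>h. 0 < dist h 0 \<and> dist h 0 < d \<longrightarrow>
        dist ((F (0 + h) - F 0) / h) (J $$ (i, j)) < e" using d(1) by blast
  qed
  then show "jacobian_mat f x $$ (i, j) = J $$ (i, j)"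
    using ij by (simp add: jacobian_mat_def dims F_def DERIV_imp_deriv)
qed (use has_jacobianD[OF J] in \<open>auto simp: jacobian_mat_def Pi_iff\<close>)

text \<open>The way back from the calculus of bounds to the norms in the conclusion of the
  theorem.\<close>

lemma diff_bounded_imp_operator_norm_le:
  assumes "diff_bounded m k f x c"
  shows "operator_norm (jacobian_mat f x) \<le> c"
proof -
  obtain J where J: "0 \<le> c" "has_jacobian m k f x J"
    "\<forall>y \<in> carrier_vec m. euclid_norm (J *\<^sub>v y) \<le> c * euclid_norm y"
    using assms by (auto simp: diff_bounded_def)
  then have "dim_col J = m" using has_jacobianD(3) by blast
  then show ?thesis
    using J operator_norm_le has_jacobian_imp_jacobian_mat by metis
qed

text \<open>The way from the hypotheses on the layers into the calculus of bounds: differentiability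
  supplies some Frechet derivative, and this must be the \<open>jacobian_mat\<close> whose norm is
  bounded.\<close>

lemma differentiable_map_imp_diff_bounded:
  assumes "differentiable_map m k f" "x \<in> carrier_vec m" "operator_norm (jacobian_mat f x) \<le> c"
  shows "diff_bounded m k f x c"
proof -
  obtain J where J: "has_jacobian m k f x J"
    using assms(1,2) unfolding differentiable_map_def has_jacobian_def by blast
  then have "operator_norm J \<le> c" using assms(3) has_jacobian_imp_jacobian_mat by blast
  moreover have "dim_col J = m" using J has_jacobianD(3) by blast
  ultimately show ?thesis
    unfolding diff_bounded_def
    using J operator_norm_nonneg[of J] euclid_norm_nonneg euclid_norm_mult_mat_vec_le[of _ J]
    by (meson mult_right_mono order_trans)
qed

lemma diff_boundedD:
  assumes "diff_bounded m k f x c"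
  shows "f \<in> carrier_vec m \<rightarrow> carrier_vec k" "x \<in> carrier_vec m" "0 \<le> c"
  using assms has_jacobianD unfolding diff_bounded_def by blast+

lemma diff_boundedE:
  assumes "diff_bounded m k f x c"
  obtains J where "has_jacobian m k f x J" "J \<in> carrier_mat k m"
    "\<And>y. y \<in> carrier_vec m \<Longrightarrow> euclid_norm (J *\<^sub>v y) \<le> c * euclid_norm y"
  using assms has_jacobianD by (auto simp: diff_bounded_def)

lemma has_jacobianE:
  assumes "has_jacobian m k f x J" "0 < e"
  obtains d where "0 < d" "\<And>y. y \<in> carrier_vec m \<Longrightarrow> euclid_norm (y - x) < d \<Longrightarrow>
        euclid_norm (f y - f x - J *\<^sub>v (y - x)) \<le> e * euclid_norm (y - x)"
  using assms by (auto simp: has_jacobian_def)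

section \<open>Rules for composing maps with bounded derivatives\<close>

text \<open>The chain rule with derivative \<open>K * J\<close>. The remainder of the composition is
  \<open>q' + K *\<^sub>v q\<close>, where \<open>q\<close> is the remainder of \<open>f\<close> at
  \<open>x\<close> and \<open>q'\<close> that of \<open>g\<close> at \<open>f x\<close>; each gets
  half of the tolerance.\<close>

lemma diff_bounded_compose:
  assumes f: "diff_bounded m k f x c" and g: "diff_bounded k p g (f x) c'"
  shows "diff_bounded m p (\<lambda>y. g (f y)) x (c' * c)"
proof -
  obtain J where J: "has_jacobian m k f x J" "J \<in> carrier_mat k m"
    and Jb: "\<And>y. y \<in> carrier_vec m \<Longrightarrow> euclid_norm (J *\<^sub>v y) \<le> c * euclid_norm y"
    using diff_boundedE[OF f] by metis
  obtain K where K: "has_jacobian k p g (f x) K" "K \<in> carrier_mat p k"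
    and Kb: "\<And>y. y \<in> carrier_vec k \<Longrightarrow> euclid_norm (K *\<^sub>v y) \<le> c' * euclid_norm y"
    using diff_boundedE[OF g] by metis
  note Df = diff_boundedD[OF f] and Dg = diff_boundedD[OF g]
  have "has_jacobian m p (\<lambda>y. g (f y)) x (K * J)"
    unfolding has_jacobian_def
  proof (intro conjI allI impI)
    show "(\<lambda>y. g (f y)) \<in> carrier_vec m \<rightarrow> carrier_vec p" using Df Dg by auto
    show "x \<in> carrier_vec m" "K * J \<in> carrier_mat p m" using Df J K by auto
    fix e :: real assume e: "0 < e"
    \<comment> \<open>\<open>e2\<close> is the tolerance for \<open>f\<close>: it is multiplied by
      \<open>c'\<close> later, and its cap 1 gives \<open>f\<close> the local Lipschitz constant
      \<open>c + 1\<close>. \<open>e1\<close> is the tolerance for \<open>g\<close>, to be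
      multiplied by \<open>c + 1\<close>. Adding 1 to \<open>c'\<close> avoids a division by
      zero.\<close>
    define e1 e2 where "e1 = e / (2 * (c + 1))" and "e2 = min 1 (e / (2 * (c' + 1)))"
    have pos: "0 < e1" "0 < e2" "e2 \<le> 1" using e Df(3) Dg(3) by (auto simp: e1_def e2_def)
    have e12: "e1 * (c + 1) = e / 2" using Df(3) by (simp add: e1_def field_simps)
    have "c' * e2 \<le> (c' + 1) * (e / (2 * (c' + 1)))"
      using pos Dg(3) by (intro mult_mono) (auto simp: e2_def)
    also have "\<dots> = e / 2" using Dg(3) by (simp add: field_simps)
    finally have e22: "c' * e2 \<le> e / 2" .
    obtain d2 where d2: "0 < d2" "\<And>y. y \<in> carrier_vec m \<Longrightarrow> euclid_norm (y - x) < d2 \<Longrightarrow>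
        euclid_norm (f y - f x - J *\<^sub>v (y - x)) \<le> e2 * euclid_norm (y - x)"
      using has_jacobianE[OF J(1) pos(2)] by metis
    obtain d1 where d1: "0 < d1" "\<And>y. y \<in> carrier_vec k \<Longrightarrow> euclid_norm (y - f x) < d1 \<Longrightarrow>
        euclid_norm (g y - g (f x) - K *\<^sub>v (y - f x)) \<le> e1 * euclid_norm (y - f x)"
      using has_jacobianE[OF K(1) pos(1)] by metis
    have "euclid_norm (g (f y) - g (f x) - K * J *\<^sub>v (y - x)) \<le> e * euclid_norm (y - x)"
      if y: "y \<in> carrier_vec m" and lt: "euclid_norm (y - x) < min d2 (d1 / (c + 1))" for y
    proof -
      let ?n = "euclid_norm (y - x)"
      define q where "q = f y - f x - J *\<^sub>v (y - x)"
      define q' where "q' = g (f y) - g (f x) - K *\<^sub>v (f y - f x)"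
      have cv: "f y \<in> carrier_vec k" "f x \<in> carrier_vec k" "g (f y) \<in> carrier_vec p"
        "g (f x) \<in> carrier_vec p" "y - x \<in> carrier_vec m" "J *\<^sub>v (y - x) \<in> carrier_vec k"
        using y Df Dg J(2) by (auto simp: Pi_iff)
      have q: "q \<in> carrier_vec k" "q' \<in> carrier_vec p" using cv K(2) by (auto simp: q_def q'_def)
      have qn: "euclid_norm q \<le> e2 * ?n" unfolding q_def using d2(2)[OF y] lt by simp
      have eq: "f y - f x = J *\<^sub>v (y - x) + q"
        using cv J(2) unfolding q_def by (intro eq_vecI) auto
      have "euclid_norm (f y - f x) \<le> c * ?n + e2 * ?n"
        unfolding eq using euclid_norm_add_le[of "J *\<^sub>v (y - x)" q] cv q J(2) Jb[OF cv(5)] qn by auto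
      also have "e2 * ?n \<le> ?n" using mult_right_mono[OF pos(3) euclid_norm_nonneg] by simp
      finally have fn: "euclid_norm (f y - f x) \<le> (c + 1) * ?n" by (simp add: algebra_simps)
      also have "\<dots> < d1" using lt Df(3) by (simp add: pos_less_divide_eq mult.commute)
      finally have "euclid_norm q' \<le> e1 * euclid_norm (f y - f x)"
        unfolding q'_def using d1(2)[OF cv(1)] by simp
      also have "\<dots> \<le> e1 * ((c + 1) * ?n)" using fn pos by (intro mult_left_mono) auto
      finally have q'n: "euclid_norm q' \<le> e / 2 * ?n" by (simp add: e12 flip: mult.assoc)
      have "euclid_norm (K *\<^sub>v q) \<le> c' * (e2 * ?n)"
        using Kb[OF q(1)] mult_left_mono[OF qn Dg(3)] by linarith
      also have "\<dots> \<le> e / 2 * ?n"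
        using mult_right_mono[OF e22 euclid_norm_nonneg] by (simp add: mult.assoc)
      finally have Kq: "euclid_norm (K *\<^sub>v q) \<le> e / 2 * ?n" .
      have "K *\<^sub>v (f y - f x) = K * J *\<^sub>v (y - x) + K *\<^sub>v q"
        unfolding eq using cv q K(2) J(2) by (simp add: mult_add_distrib_mat_vec)
      then have "g (f y) - g (f x) - K * J *\<^sub>v (y - x) = q' + K *\<^sub>v q"
        using cv q K(2) J(2) by (auto simp: q'_def)
      then show ?thesis
        using euclid_norm_add_le[of q' "K *\<^sub>v q"] q K(2) q'n Kq by auto
    qed
    moreover have "0 < min d2 (d1 / (c + 1))" using d1 d2 Df(3) by auto
    ultimately show "\<exists>d>0. \<forall>y\<in>carrier_vec m. euclid_norm (y - x) < d \<longrightarrow>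
        euclid_norm (g (f y) - g (f x) - K * J *\<^sub>v (y - x)) \<le> e * euclid_norm (y - x)" by blast
  qed
  moreover have "euclid_norm (K * J *\<^sub>v y) \<le> c' * c * euclid_norm y" if y: "y \<in> carrier_vec m" for y
  proof -
    have "euclid_norm (K *\<^sub>v (J *\<^sub>v y)) \<le> c' * (c * euclid_norm y)"
      using Kb[of "J *\<^sub>v y"] mult_left_mono[OF Jb[OF y] Dg(3)] J(2) y by auto
    then show ?thesis using J(2) K(2) y by (simp add: mult.assoc)
  qed
  ultimately show ?thesis using Df(3) Dg(3) by (auto simp: diff_bounded_def)
qed

text \<open>The norm of a concatenation is at most the sum of the norms, so the bounds add. This is
  cruder than the Euclidean combination of \<open>c\<close> and \<open>c'\<close>, but keeps the
  recursion over the layers linear.\<close>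

lemma diff_bounded_append:
  assumes f: "diff_bounded m k f x c" and g: "diff_bounded m p g x c'"
  shows "diff_bounded m (k + p) (\<lambda>y. f y @\<^sub>v g y) x (c + c')"
proof -
  obtain J where J: "has_jacobian m k f x J" "J \<in> carrier_mat k m"
    and Jb: "\<And>y. y \<in> carrier_vec m \<Longrightarrow> euclid_norm (J *\<^sub>v y) \<le> c * euclid_norm y"
    using diff_boundedE[OF f] by metis
  obtain K where K: "has_jacobian m p g x K" "K \<in> carrier_mat p m"
    and Kb: "\<And>y. y \<in> carrier_vec m \<Longrightarrow> euclid_norm (K *\<^sub>v y) \<le> c' * euclid_norm y"
    using diff_boundedE[OF g] by metis
  note Df = diff_boundedD[OF f] and Dg = diff_boundedD[OF g]
  have "has_jacobian m (k + p) (\<lambda>y. f y @\<^sub>v g y) x (J @\<^sub>r K)"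
    unfolding has_jacobian_def
  proof (intro conjI allI impI)
    show "(\<lambda>y. f y @\<^sub>v g y) \<in> carrier_vec m \<rightarrow> carrier_vec (k + p)" using Df Dg by auto
    show "x \<in> carrier_vec m" "J @\<^sub>r K \<in> carrier_mat (k + p) m" using Df J K by auto
    fix e :: real assume e: "0 < e"
    obtain d1 where d1: "0 < d1" "\<And>y. y \<in> carrier_vec m \<Longrightarrow> euclid_norm (y - x) < d1 \<Longrightarrow>
        euclid_norm (f y - f x - J *\<^sub>v (y - x)) \<le> e / 2 * euclid_norm (y - x)"
      using has_jacobianE[OF J(1), of "e / 2"] e by auto
    obtain d2 where d2: "0 < d2" "\<And>y. y \<in> carrier_vec m \<Longrightarrow> euclid_norm (y - x) < d2 \<Longrightarrow>
        euclid_norm (g y - g x - K *\<^sub>v (y - x)) \<le> e / 2 * euclid_norm (y - x)"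
      using has_jacobianE[OF K(1), of "e / 2"] e by auto
    have "euclid_norm ((f y @\<^sub>v g y) - (f x @\<^sub>v g x) - (J @\<^sub>r K) *\<^sub>v (y - x)) \<le> e * euclid_norm (y - x)"
      if y: "y \<in> carrier_vec m" and lt: "euclid_norm (y - x) < min d1 d2" for y
    proof -
      have cv: "f y \<in> carrier_vec k" "f x \<in> carrier_vec k" "g y \<in> carrier_vec p"
        "g x \<in> carrier_vec p" "y - x \<in> carrier_vec m"
        using y Df Dg by (auto simp: Pi_iff)
      have "(f y @\<^sub>v g y) - (f x @\<^sub>v g x) - (J @\<^sub>r K) *\<^sub>v (y - x)
          = (f y - f x - J *\<^sub>v (y - x)) @\<^sub>v (g y - g x - K *\<^sub>v (y - x))"
        unfolding mat_mult_append[OF J(2) K(2) cv(5)] using cv J(2) K(2) by (intro eq_vecI) auto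
      then show ?thesis
        using euclid_norm_append_le[of "f y - f x - J *\<^sub>v (y - x)" "g y - g x - K *\<^sub>v (y - x)"]
          d1(2)[OF y] d2(2)[OF y] lt by auto
    qed
    moreover have "0 < min d1 d2" using d1 d2 by auto
    ultimately show "\<exists>d>0. \<forall>y\<in>carrier_vec m. euclid_norm (y - x) < d \<longrightarrow>
        euclid_norm ((f y @\<^sub>v g y) - (f x @\<^sub>v g x) - (J @\<^sub>r K) *\<^sub>v (y - x)) \<le> e * euclid_norm (y - x)"
      by blast
  qed
  moreover have "euclid_norm ((J @\<^sub>r K) *\<^sub>v y) \<le> (c + c') * euclid_norm y"
    if y: "y \<in> carrier_vec m" for y
    using euclid_norm_append_le[of "J *\<^sub>v y" "K *\<^sub>v y"] Jb[OF y] Kb[OF y]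
    by (simp add: mat_mult_append[OF J(2) K(2) y] distrib_right)
  ultimately show ?thesis using Df(3) Dg(3) by (auto simp: diff_bounded_def)
qed

text \<open>Scaling and addition are treated together because this is the induction step for
  weighted sums over neighbours.\<close>

lemma diff_bounded_smult_add:
  assumes f: "diff_bounded m k f x c" and g: "diff_bounded m k g x c'"
  shows "diff_bounded m k (\<lambda>y. a \<cdot>\<^sub>v f y + g y) x (\<bar>a\<bar> * c + c')"
proof -
  obtain J where J: "has_jacobian m k f x J" "J \<in> carrier_mat k m"
    and Jb: "\<And>y. y \<in> carrier_vec m \<Longrightarrow> euclid_norm (J *\<^sub>v y) \<le> c * euclid_norm y"
    using diff_boundedE[OF f] by metis
  obtain K where K: "has_jacobian m k g x K" "K \<in> carrier_mat k m"
    and Kb: "\<And>y. y \<in> carrier_vec m \<Longrightarrow> euclid_norm (K *\<^sub>v y) \<le> c' * euclid_norm y"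
    using diff_boundedE[OF g] by metis
  note Df = diff_boundedD[OF f] and Dg = diff_boundedD[OF g]
  have mult: "(a \<cdot>\<^sub>m J + K) *\<^sub>v y = a \<cdot>\<^sub>v (J *\<^sub>v y) + K *\<^sub>v y" if "y \<in> carrier_vec m" for y
    using J(2) K(2) that
    by (intro eq_vecI) (auto simp: add_scalar_prod_distrib[of _ m])
  have "has_jacobian m k (\<lambda>y. a \<cdot>\<^sub>v f y + g y) x (a \<cdot>\<^sub>m J + K)"
    unfolding has_jacobian_def
  proof (intro conjI allI impI)
    show "(\<lambda>y. a \<cdot>\<^sub>v f y + g y) \<in> carrier_vec m \<rightarrow> carrier_vec k"
      using Df Dg by (auto simp: Pi_iff intro!: add_carrier_vec)
    show "x \<in> carrier_vec m" "a \<cdot>\<^sub>m J + K \<in> carrier_mat k m" using Df J K by auto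
    fix e :: real assume e: "0 < e"
    define e1 where "e1 = e / (2 * (\<bar>a\<bar> + 1))"
    have e1: "0 < e1" using e by (auto simp: e1_def)
    have "\<bar>a\<bar> * e1 \<le> (\<bar>a\<bar> + 1) * e1" using e1 by (intro mult_right_mono) auto
    also have "\<dots> = e / 2" by (simp add: e1_def add_nonneg_eq_0_iff field_simps)
    finally have ae1: "\<bar>a\<bar> * e1 \<le> e / 2" .
    obtain d1 where d1: "0 < d1" "\<And>y. y \<in> carrier_vec m \<Longrightarrow> euclid_norm (y - x) < d1 \<Longrightarrow>
        euclid_norm (f y - f x - J *\<^sub>v (y - x)) \<le> e1 * euclid_norm (y - x)"
      using has_jacobianE[OF J(1) e1] by metis
    obtain d2 where d2: "0 < d2" "\<And>y. y \<in> carrier_vec m \<Longrightarrow> euclid_norm (y - x) < d2 \<Longrightarrow>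
        euclid_norm (g y - g x - K *\<^sub>v (y - x)) \<le> e / 2 * euclid_norm (y - x)"
      using has_jacobianE[OF K(1), of "e / 2"] e by auto
    have "euclid_norm (a \<cdot>\<^sub>v f y + g y - (a \<cdot>\<^sub>v f x + g x) - (a \<cdot>\<^sub>m J + K) *\<^sub>v (y - x))
        \<le> e * euclid_norm (y - x)"
      if y: "y \<in> carrier_vec m" and lt: "euclid_norm (y - x) < min d1 d2" for y
    proof -
      let ?n = "euclid_norm (y - x)"
      define q where "q = f y - f x - J *\<^sub>v (y - x)"
      define q' where "q' = g y - g x - K *\<^sub>v (y - x)"
      have cv: "f y \<in> carrier_vec k" "f x \<in> carrier_vec k" "g y \<in> carrier_vec k"
        "g x \<in> carrier_vec k" "y - x \<in> carrier_vec m"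
        using y Df Dg by (auto simp: Pi_iff)
      have "a \<cdot>\<^sub>v f y + g y - (a \<cdot>\<^sub>v f x + g x) - (a \<cdot>\<^sub>m J + K) *\<^sub>v (y - x) = a \<cdot>\<^sub>v q + q'"
        unfolding mult[OF cv(5)] q_def q'_def
        using cv J(2) K(2) by (intro eq_vecI) (auto simp: algebra_simps)
      moreover have "\<bar>a\<bar> * euclid_norm q \<le> e / 2 * ?n"
      proof -
        have "\<bar>a\<bar> * euclid_norm q \<le> \<bar>a\<bar> * (e1 * ?n)"
          unfolding q_def using d1(2)[OF y] lt by (intro mult_left_mono) auto
        also have "\<dots> \<le> e / 2 * ?n"
          using mult_right_mono[OF ae1 euclid_norm_nonneg] by (simp add: mult.assoc)
        finally show ?thesis .
      qed
      moreover have "euclid_norm q' \<le> e / 2 * ?n" unfolding q'_def using d2(2)[OF y] lt by auto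
      ultimately show ?thesis
        using euclid_norm_add_le[of "a \<cdot>\<^sub>v q" q'] cv J(2) K(2)
        by (auto simp: euclid_norm_smult q_def q'_def)
    qed
    moreover have "0 < min d1 d2" using d1 d2 by auto
    ultimately show "\<exists>d>0. \<forall>y\<in>carrier_vec m. euclid_norm (y - x) < d \<longrightarrow>
        euclid_norm (a \<cdot>\<^sub>v f y + g y - (a \<cdot>\<^sub>v f x + g x) - (a \<cdot>\<^sub>m J + K) *\<^sub>v (y - x))
          \<le> e * euclid_norm (y - x)"
      by blast
  qed
  moreover have "euclid_norm ((a \<cdot>\<^sub>m J + K) *\<^sub>v y) \<le> (\<bar>a\<bar> * c + c') * euclid_norm y"
    if y: "y \<in> carrier_vec m" for y
    using euclid_norm_add_le[of "a \<cdot>\<^sub>v (J *\<^sub>v y)" "K *\<^sub>v y"] mult_left_mono[OF Jb[OF y], of "\<bar>a\<bar>"]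
      Kb[OF y] J(2) K(2)
    by (simp add: mult[OF y] euclid_norm_smult algebra_simps)
  ultimately show ?thesis using Df(3) Dg(3) by (auto simp: diff_bounded_def)
qed

text \<open>Equality is required on the carrier only, since the identities that rewrite a layer hold
  only for vectors of the right dimension.\<close>

lemma diff_bounded_cong:
  assumes "diff_bounded m k h x c" "\<And>y. y \<in> carrier_vec m \<Longrightarrow> g y = h y"
  shows "diff_bounded m k g x c"
  using assms diff_boundedD(2)[OF assms(1)]
  unfolding diff_bounded_def has_jacobian_def by (auto simp: Pi_iff)

lemma diff_bounded_mono:
  assumes "diff_bounded m k f x c" "c \<le> c'"
  shows "diff_bounded m k f x c'"
  using assms euclid_norm_nonneg unfolding diff_bounded_def
  by (meson mult_right_mono order_trans)

lemma diff_bounded_const: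
  assumes "v \<in> carrier_vec k" "x \<in> carrier_vec m"
  shows "diff_bounded m k (\<lambda>_. v) x 0"
proof -
  have *: "0\<^sub>m k m *\<^sub>v y = 0\<^sub>v k" if "y \<in> carrier_vec m" for y :: "real vec"
    using that by (intro eq_vecI) auto
  have "v - v - 0\<^sub>m k m *\<^sub>v (y - x) = 0\<^sub>v k" if "y \<in> carrier_vec m" for y :: "real vec"
    using assms that by (subst *) auto
  then have "has_jacobian m k (\<lambda>_. v) x (0\<^sub>m k m)"
    unfolding has_jacobian_def using assms
    by (auto simp: euclid_norm_zero euclid_norm_nonneg intro!: exI[of _ "1::real"])
  then show ?thesis
    unfolding diff_bounded_def by (auto simp: * euclid_norm_zero)
qed

lemma diff_bounded_id:
  assumes "x \<in> carrier_vec m"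
  shows "diff_bounded m m (\<lambda>y. y) x 1"
proof -
  have *: "euclid_norm (y - x - (y - x)) = 0" if "y \<in> carrier_vec m" for y :: "real vec"
  proof -
    have "y - x - (y - x) = 0\<^sub>v m" using assms that by auto
    then show ?thesis by (simp add: euclid_norm_zero)
  qed
  have "has_jacobian m m (\<lambda>y. y) x (1\<^sub>m m)"
    unfolding has_jacobian_def using assms
    by (auto simp: * euclid_norm_nonneg intro!: exI[of _ "1::real"])
  then show ?thesis
    unfolding diff_bounded_def by auto
qed

lemma diff_bounded_finsum:
  assumes "finite S" "x \<in> carrier_vec m" "\<And>u. u \<in> S \<Longrightarrow> diff_bounded m k (f u) x (c u)"
  shows "diff_bounded m k (\<lambda>y. finsum_vec TYPE(real) k (\<lambda>u. a u \<cdot>\<^sub>v f u y) S) x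
           (\<Sum>u\<in>S. \<bar>a u\<bar> * c u)"
  using assms(1,3)
proof (induction S)
  case empty
  then show ?case using diff_bounded_const[of "0\<^sub>v k" k x m] assms(2) by (simp add: finsum_vec_empty)
next
  case (insert w S)
  have fw: "diff_bounded m k (f w) x (c w)" and
    IH: "diff_bounded m k (\<lambda>y. finsum_vec TYPE(real) k (\<lambda>u. a u \<cdot>\<^sub>v f u y) S) x (\<Sum>u\<in>S. \<bar>a u\<bar> * c u)"
    using insert by auto
  have fc: "f u y \<in> carrier_vec k" if "u \<in> insert w S" "y \<in> carrier_vec m" for u y
    using diff_boundedD(1)[OF insert.prems[OF that(1)]] that(2) by auto
  show ?case
    unfolding sum.insert[OF insert.hyps]
  proof (rule diff_bounded_cong[OF diff_bounded_smult_add[OF fw IH]])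
    fix y :: "real vec" assume "y \<in> carrier_vec m"
    then show "finsum_vec TYPE(real) k (\<lambda>u. a u \<cdot>\<^sub>v f u y) (insert w S)
        = a w \<cdot>\<^sub>v f w y + finsum_vec TYPE(real) k (\<lambda>u. a u \<cdot>\<^sub>v f u y) S"
      using fc insert.hyps by (subst finsum_vec_insert) auto
  qed
qed

lemma joint_append:
  assumes "y \<in> carrier_vec a" "z \<in> carrier_vec b"
  shows "joint a b f (y @\<^sub>v z) = f y z"
proof -
  have "vec_first (y @\<^sub>v z) a = y" "vec_last (y @\<^sub>v z) b = z"
    using assms by (auto simp: vec_first_def vec_last_def)
  then show ?thesis by (simp add: joint_def)
qed

section \<open>Propagation of derivative bounds through the network\<close>

text \<open>Induction over the layers with the chain rule. \<open>C\<close> may be any majorant of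
  the resulting recursion, which keeps the analysis apart from the combinatorics of walks. At layer
  0 the map is the identity for \<open>w = v\<close> and constant otherwise.\<close>

lemma gnn_feature_diff_bounded:
  fixes E :: "'v::finite \<Rightarrow> 'v \<Rightarrow> bool" and C :: "nat \<Rightarrow> 'v \<Rightarrow> real"
  assumes maps: "gnn_maps fdim mdim \<phi> \<psi>"
    and x: "\<And>w. x w \<in> carrier_vec (fdim 0)"
    and \<phi>: "\<And>l z. z \<in> carrier_vec (fdim l + mdim l) \<Longrightarrow>
           operator_norm (jacobian_mat (joint (fdim l) (mdim l) (\<phi> l)) z) \<le> \<alpha>"
    and \<psi>: "\<And>l z. z \<in> carrier_vec (fdim l) \<Longrightarrow> operator_norm (jacobian_mat (\<psi> l) z) \<le> \<beta>"
    and C0: "C 0 v = 1" "\<And>w. 0 \<le> C 0 w"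
    and CS: "\<And>l w. \<alpha> * (C l w + \<beta> * (\<Sum>u\<in>neighbors E w. \<bar>normalized_adjacency E $ u $ w\<bar> * C l u)) \<le> C (Suc l) w"
  shows "diff_bounded (fdim 0) (fdim l) (\<lambda>z. gnn_feature E mdim \<phi> \<psi> (x(v := z)) l w) (x v) (C l w)"
proof (induction l arbitrary: w)
  case 0
  show ?case
  proof (cases "w = v")
    case True
    then show ?thesis using diff_bounded_id[OF x] C0 by simp
  next
    case False
    then show ?thesis
      using diff_bounded_mono[OF diff_bounded_const[OF x x] C0(2)] by simp
  qed
next
  case (Suc l)
  let ?f = "\<lambda>w z. gnn_feature E mdim \<phi> \<psi> (x(v := z)) l w"
  let ?A = "\<lambda>u w. normalized_adjacency E $ u $ w"
  let ?S = "\<lambda>z. finsum_vec TYPE(real) (mdim l) (\<lambda>u. ?A u w \<cdot>\<^sub>v \<psi> l (?f u z)) (neighbors E w)"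
  have d: "differentiable_map (fdim l + mdim l) (fdim (Suc l)) (joint (fdim l) (mdim l) (\<phi> l))"
    "differentiable_map (fdim l) (mdim l) (\<psi> l)" using maps by (auto simp: gnn_maps_def)
  have f: "?f u z \<in> carrier_vec (fdim l)" if "z \<in> carrier_vec (fdim 0)" for u z
    by (rule funcset_mem[OF diff_boundedD(1)[OF Suc] that])
  \<comment> \<open>The derivative is taken at \<open>z = x v\<close>, where
    \<open>x(v := z)\<close> is \<open>x\<close> itself; hence the bound on \<open>\<psi> l\<close>
    is applied at the actual features of layer \<open>l\<close>.\<close>
  have "diff_bounded (fdim 0) (mdim l) (\<lambda>z. \<psi> l (?f u z)) (x v) (\<beta> * C l u)" for u
    by (rule diff_bounded_compose[OF Suc differentiable_map_imp_diff_bounded[OF d(2)]])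
      (use f[OF x[of v], unfolded fun_upd_triv] \<psi> in auto)
  then have "diff_bounded (fdim 0) (mdim l) ?S (x v) (\<Sum>u\<in>neighbors E w. \<bar>?A u w\<bar> * (\<beta> * C l u))"
    by (intro diff_bounded_finsum x) auto
  \<comment> \<open>\<open>\<phi> l\<close> is differentiated jointly, so the vertex's own feature
    and the aggregated message are concatenated into one argument.\<close>
  note S = diff_bounded_append[OF Suc[of w] this]
  have Sc: "?S z \<in> carrier_vec (mdim l)" if "z \<in> carrier_vec (fdim 0)" for z
    using d(2) f[OF that] by (intro finsum_vec_closed) (auto simp: differentiable_map_def)
  have "diff_bounded (fdim 0) (fdim (Suc l)) (\<lambda>z. joint (fdim l) (mdim l) (\<phi> l) (?f w z @\<^sub>v ?S z)) (x v)
      (\<alpha> * (C l w + (\<Sum>u\<in>neighbors E w. \<bar>?A u w\<bar> * (\<beta> * C l u))))"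
    by (rule diff_bounded_compose[OF S differentiable_map_imp_diff_bounded[OF d(1)]])
      (use f[OF x[of v], unfolded fun_upd_triv] Sc[OF x[of v], unfolded fun_upd_triv] \<phi> in \<open>auto intro!: append_carrier_vec\<close>)
  then have "diff_bounded (fdim 0) (fdim (Suc l)) (\<lambda>z. joint (fdim l) (mdim l) (\<phi> l) (?f w z @\<^sub>v ?S z)) (x v)
      (C (Suc l) w)"
    using CS[of l w] by (elim diff_bounded_mono) (simp add: sum_distrib_left mult.left_commute)
  then show ?case
    by (rule diff_bounded_cong) (simp only: joint_append[OF f Sc] gnn_feature.simps)
qed

section \<open>Symmetric matrices and pseudoinverses\<close>

text \<open>
  A maximizer \<open>y\<close> of \<open>norm (T y)\<close> on the unit sphere of \<open>H\<close> satisfies \<open>T (T y) = s\<^sup>2 y\<close> where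
  \<open>s = norm (T y)\<close>, so either \<open>T y = - s y\<close> or \<open>T y + s y\<close> is an eigenvector for \<open>s\<close>.
\<close>
lemma symmetric_invariant_subspace_eigenvector:
  fixes T :: "'a::euclidean_space \<Rightarrow> 'a"
  assumes lin: "linear T" and sym: "\<And>x y. inner (T x) y = inner x (T y)"
    and H: "subspace H" "\<And>x. x \<in> H \<Longrightarrow> T x \<in> H" and ex: "x0 \<in> H" "x0 \<noteq> 0"
  obtains y c where "y \<in> H" "y \<noteq> 0" "T y = c *\<^sub>R y" "\<And>x. x \<in> H \<Longrightarrow> norm (T x) \<le> \<bar>c\<bar> * norm x"
proof -
  interpret linear T by (rule lin)
  have "compact (sphere 0 1 \<inter> H)"
    using H(1) by (simp add: closed_subspace compact_Int_closed)
  moreover have "(1 / norm x0) *\<^sub>R x0 \<in> sphere 0 1 \<inter> H"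
    using ex H(1) by (simp add: subspace_scale)
  then have "sphere 0 1 \<inter> H \<noteq> {}" by blast
  moreover have "continuous_on (sphere 0 1 \<inter> H) (\<lambda>x. norm (T x))"
    by (intro continuous_on_norm linear_continuous_on linear_conv_bounded_linear[THEN iffD1] lin)
  ultimately obtain y where "y \<in> sphere 0 1 \<inter> H"
    and "\<forall>x\<in>sphere 0 1 \<inter> H. norm (T x) \<le> norm (T y)"
    using continuous_attains_sup[of "sphere 0 1 \<inter> H" "\<lambda>x. norm (T x)"] by metis
  then have y: "norm y = 1" "y \<in> H"
    and max: "\<And>x. norm x = 1 \<Longrightarrow> x \<in> H \<Longrightarrow> norm (T x) \<le> norm (T y)" by auto
  define s where "s = norm (T y)"
  have bound: "norm (T x) \<le> s * norm x" if "x \<in> H" for x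
  proof (cases "x = 0")
    case False
    have "norm (T ((1 / norm x) *\<^sub>R x)) \<le> s"
      unfolding s_def using False that H(1) by (intro max) (auto intro: subspace_scale)
    then show ?thesis using False by (simp add: scale field_simps)
  qed (simp add: zero)
  have "norm (T (T y)) \<le> s\<^sup>2"
    using bound[OF H(2)[OF y(2)]] by (simp add: s_def power2_eq_square)
  then have "(norm (T (T y)))\<^sup>2 \<le> (s\<^sup>2)\<^sup>2" by (intro power_mono) auto
  moreover have Ty: "inner (T (T y)) y = s\<^sup>2"
    using sym[of "T y" y] power2_norm_eq_inner[of "T y"] unfolding s_def by linarith
  \<comment> \<open>Expanding the square leaves
    \<open>(norm (T (T y)))\<^sup>2 - (s\<^sup>2)\<^sup>2\<close>, which is nonpositive because
    \<open>s\<close> bounds \<open>T\<close> on \<open>H\<close>.\<close>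
  have "(norm (T (T y) - s\<^sup>2 *\<^sub>R y))\<^sup>2
      = (norm (T (T y)))\<^sup>2 - 2 * s\<^sup>2 * inner (T (T y)) y + (s\<^sup>2)\<^sup>2 * (norm y)\<^sup>2"
    unfolding power2_norm_eq_inner inner_diff_left inner_diff_right inner_scaleR_left
      inner_scaleR_right inner_commute[of y "T (T y)"] power2_eq_square[of "s\<^sup>2"]
    by (simp add: algebra_simps)
  then have "(norm (T (T y) - s\<^sup>2 *\<^sub>R y))\<^sup>2 = (norm (T (T y)))\<^sup>2 - (s\<^sup>2)\<^sup>2"
    unfolding Ty y(1) by (simp add: power2_eq_square)
  ultimately have "(norm (T (T y) - s\<^sup>2 *\<^sub>R y))\<^sup>2 \<le> 0" by linarith
  then have "T (T y) = s\<^sup>2 *\<^sub>R y" by simp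
  then have TTy: "T (T y) = s *\<^sub>R s *\<^sub>R y" by (simp add: power2_eq_square)
  have s: "0 \<le> s" by (simp add: s_def)
  show thesis
  proof (cases "T y + s *\<^sub>R y = 0")
    case True
    then have "T y = (- s) *\<^sub>R y" by (simp add: add_eq_0_iff2)
    then show ?thesis using that[of y "- s"] y bound s by fastforce
  next
    case False
    have "T (T y + s *\<^sub>R y) = s *\<^sub>R (T y + s *\<^sub>R y)"
      by (simp add: add scale TTy scaleR_right_distrib add.commute)
    moreover have "T y + s *\<^sub>R y \<in> H" using y H by (simp add: subspace_add subspace_scale)
    ultimately show ?thesis using that[of "T y + s *\<^sub>R y" s] False bound s by simp
  qed
qed

lemma mat_mult_vector: "Finite_Cartesian_Product.mat c *v (y :: real^'n) = c *\<^sub>R y"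
  by (simp add: Finite_Cartesian_Product.mat_def matrix_vector_mult_def Finite_Cartesian_Product.vec_eq_iff
      if_distrib[of "\<lambda>z. z * _"] cong: if_cong)

text \<open>An eigenvector makes the matrix \<open>c - M\<close> singular, so \<open>c\<close> is a
  root of the factored characteristic polynomial.\<close>

lemma ordered_eigenvalues_eigenvector:
  fixes M :: "real^'n::finite^'n"
  assumes ev: "ordered_eigenvalues M mu" and y: "y \<noteq> 0" "M *v y = c *\<^sub>R y"
  shows "\<exists>i\<in>{1..CARD('n)}. c = mu i"
proof -
  have "(Finite_Cartesian_Product.mat c - M) *v y = 0"
    using y(2) by (simp add: matrix_vector_mult_diff_rdistrib mat_mult_vector)
  then have "\<not> invertible (Finite_Cartesian_Product.mat c - M)"
    using y(1) by (auto simp: invertible_left_inverse matrix_left_invertible_ker)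
  then have "(\<Prod>i = 1..CARD('n). c - mu i) = 0"
    using ev unfolding ordered_eigenvalues_def by (metis invertible_det_nz)
  then show ?thesis by auto
qed

lemma matrix_add_rdistrib: "(B + C) ** M = B ** M + C ** (M :: real^'n^'m)"
  by (simp add: matrix_matrix_mult_def Finite_Cartesian_Product.vec_eq_iff distrib_right sum.distrib)

text \<open>Uniqueness of the Moore-Penrose inverse. Transposing a product of two of the symmetric
  matrices swaps the factors, which yields \<open>X ** M = Y ** M\<close> and
  \<open>M ** X = M ** Y\<close>; then \<open>X = X M X = Y M X = Y M Y = Y\<close>.\<close>

lemma pseudoinverse_eqI:
  assumes X: "M ** X ** M = M" "X ** M ** X = X"
    "transpose (M ** X) = M ** X" "transpose (X ** M) = X ** M"
  shows "pseudoinverse M = X"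
  unfolding pseudoinverse_def
proof (rule the_equality)
  fix Y assume "M ** Y ** M = M \<and> Y ** M ** Y = Y \<and>
    transpose (M ** Y) = M ** Y \<and> transpose (Y ** M) = Y ** M"
  then have Y: "M ** Y ** M = M" "Y ** M ** Y = Y"
    "transpose (M ** Y) = M ** Y" "transpose (Y ** M) = Y ** M" by auto
  have "(X ** M) ** (Y ** M) = X ** (M ** Y ** M)" by (simp only: matrix_mul_assoc)
  then have "X ** M = transpose ((X ** M) ** (Y ** M))" by (simp only: X Y)
  also have "\<dots> = (Y ** M) ** (X ** M)" by (simp only: matrix_transpose_mul[of "X ** M"] X Y)
  also have "\<dots> = Y ** (M ** X ** M)" by (simp only: matrix_mul_assoc)
  finally have XM: "X ** M = Y ** M" by (simp only: X)
  have "(M ** Y) ** (M ** X) = (M ** Y ** M) ** X" by (simp only: matrix_mul_assoc)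
  then have "M ** X = transpose ((M ** Y) ** (M ** X))" by (simp only: X Y)
  also have "\<dots> = (M ** X) ** (M ** Y)" by (simp only: matrix_transpose_mul[of "M ** Y"] X Y)
  also have "\<dots> = (M ** X ** M) ** Y" by (simp only: matrix_mul_assoc)
  finally have MX: "M ** X = M ** Y" by (simp only: X)
  have "X = Y ** M ** X" using X(2) by (simp only: XM)
  also have "\<dots> = Y ** (M ** Y)" by (simp only: MX flip: matrix_mul_assoc)
  also have "\<dots> = Y" using Y(2) by (simp only: matrix_mul_assoc)
  finally show "Y = X" by simp
qed (use X in auto)

lemma effective_resistance_commute: "effective_resistance E u v = effective_resistance E v u"
proof -
  have *: "axis u 1 - axis v 1 = - (axis v 1 - axis u (1::real))" by simp
  show ?thesis
    unfolding effective_resistance_def * linear_neg[OF matrix_vector_mul_linear]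
      inner_minus_left inner_minus_right by simp
qed

lemma diag_matrix_mult_left: "(diag_matrix f ** M) $ i $ j = f i * M $ i $ j"
  by (simp add: diag_matrix_def matrix_matrix_mult_def if_distrib[of "\<lambda>z. z * _"] cong: if_cong)

lemma diag_matrix_mult_right: "(M ** diag_matrix f) $ i $ j = M $ i $ j * f j"
  by (simp add: diag_matrix_def matrix_matrix_mult_def if_distrib[of "\<lambda>z. _ * z"] cong: if_cong)

section \<open>Walks and effective resistance\<close>

text \<open>With connectedness, \<open>nontrivial\<close> makes every degree positive, so that
  degrees and their roots can be divided by.\<close>

locale connected_simple_graph =
  fixes E :: "'v::finite \<Rightarrow> 'v \<Rightarrow> bool"
  assumes simple: "simple_graph E" and connected: "connected_graph E"
    and nontrivial: "\<exists>u v. E u v"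
begin

abbreviation "d u \<equiv> real (vertex_degree E u)"
abbreviation "A \<equiv> normalized_adjacency E"
abbreviation "N u \<equiv> neighbors E u"

text \<open>The vector \<open>D^(1/2) 1\<close>, an eigenvector of \<open>A\<close> for the
  eigenvalue 1.\<close>

definition root_deg :: "real^'v" where "root_deg = (\<chi> u. sqrt (d u))"

text \<open>Multiplication by \<open>A^l\<close>. Hence \<open>walk l (axis v 1) $ u\<close> is the
  entry of \<open>A^l\<close> at \<open>u\<close>, \<open>v\<close>, a weighted count of the walks
  of length \<open>l\<close> between the two vertices.\<close>

definition walk :: "nat \<Rightarrow> real^'v \<Rightarrow> real^'v" where "walk l = ((*v) A) ^^ l"

lemma E_sym: "E u v \<longleftrightarrow> E v u"
  using simple by (auto simp: simple_graph_def dest: sympD)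

lemma has_neighbor: "\<exists>v. E u v"
proof -
  obtain a b where ab: "E a b" using nontrivial by blast
  have "E\<^sup>*\<^sup>* u a" using connected by (simp add: connected_graph_def)
  then show ?thesis using ab by (cases rule: converse_rtranclpE) auto
qed

lemma deg_pos: "0 < d u"
  using has_neighbor[of u] by (auto simp: vertex_degree_def neighbors_def card_gt_0_iff)

lemma A_nth: "A $ u $ v = (if E u v then 1 / (sqrt (d u) * sqrt (d v)) else 0)"
  unfolding normalized_adjacency_def diag_matrix_mult_right diag_matrix_mult_left
  by (simp add: adjacency_def)

lemma A_commute: "A $ u $ v = A $ v $ u"
  using E_sym[of u v] by (simp add: A_nth mult.commute)

lemma A_nonneg: "0 \<le> A $ u $ v"
  by (simp add: A_nth)

lemma A_mult_nth: "(A *v x) $ u = (\<Sum>v\<in>N u. x $ v / sqrt (d v)) / sqrt (d u)"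
proof -
  have "(A *v x) $ u = (\<Sum>v\<in>UNIV. if E u v then x $ v / sqrt (d v) / sqrt (d u) else 0)"
    unfolding matrix_vector_mult_def by (auto simp: A_nth intro!: sum.cong)
  also have "\<dots> = (\<Sum>v\<in>N u. x $ v / sqrt (d v) / sqrt (d u))"
    by (simp add: neighbors_def sum.If_cases)
  finally show ?thesis by (simp add: sum_divide_distrib)
qed

lemma A_inner: "inner (A *v x) y = inner x (A *v y)"
proof -
  have "transpose A = A"
    by (simp add: Finite_Cartesian_Product.vec_eq_iff Finite_Cartesian_Product.transpose_def A_commute)
  then show ?thesis by (metis dot_lmul_matrix transpose_matrix_vector)
qed

lemma A_root_deg: "A *v root_deg = root_deg"
proof -
  have "(\<Sum>v\<in>N u. root_deg $ v / sqrt (d v)) = d u" for u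
    using deg_pos by (simp add: root_deg_def vertex_degree_def less_imp_neq[THEN not_sym])
  then show ?thesis
    using deg_pos by (simp add: Finite_Cartesian_Product.vec_eq_iff A_mult_nth root_deg_def real_div_sqrt)
qed

section \<open>Simplicity of the eigenvalue 1 and the spectral gap\<close>

text \<open>The maximum principle, which serves both for the eigenvalue 1 of \<open>A\<close> and
  for the kernel of the Laplacian.\<close>

lemma harmonic_imp_constant:
  assumes harm: "\<And>u. d u * g u = (\<Sum>v\<in>N u. g v)"
  shows "g u = g v"
proof -
  obtain m where m: "\<And>u. g u \<le> g m"
  proof -
    have "Max (range g) \<in> range g" by (intro Max_in) auto
    then show ?thesis using that by (metis Max_ge finite finite_imageI imageE rangeI)
  qed
  \<comment> \<open>\<open>g u\<close> is the average of \<open>g\<close> over the neighbours of \<open>u\<close>, so a maximum spreads along edges\<close>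
  have step: "g v = g m" if "g u = g m" "E u v" for u v
  proof -
    have "(\<Sum>v\<in>N u. g m - g v) = 0"
      using harm[of u] that(1) by (simp add: sum_subtractf vertex_degree_def)
    then show ?thesis
      using m that(2) by (subst (asm) sum_nonneg_eq_0_iff) (auto simp: neighbors_def)
  qed
  have "g v = g m" for v
  proof -
    have "E\<^sup>*\<^sup>* m v" using connected by (simp add: connected_graph_def)
    then show ?thesis by induction (auto intro: step)
  qed
  then show ?thesis by metis
qed

text \<open>Writing \<open>y = D^(1/2) g\<close> turns \<open>A y = y\<close> into harmonicity of
  \<open>g\<close>. So \<open>g\<close> is constant, \<open>y\<close> is a multiple of
  \<open>root_deg\<close>, and orthogonality leaves only 0.\<close>

lemma A_fixed_orthogonal_eq_0:
  assumes "A *v y = y" "inner root_deg y = 0"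
  shows "y = 0"
proof -
  define g where "g u = y $ u / sqrt (d u)" for u
  have "d u * g u = (\<Sum>v\<in>N u. g v)" for u
  proof -
    have "y $ u = (\<Sum>v\<in>N u. g v) / sqrt (d u)"
      using arg_cong[OF assms(1), of "\<lambda>z. z $ u"] by (simp add: A_mult_nth g_def)
    then have "(\<Sum>v\<in>N u. g v) = y $ u * sqrt (d u)" using deg_pos[of u] by (simp add: field_simps)
    also have "\<dots> = y $ u * (d u / sqrt (d u))" by (simp add: real_div_sqrt)
    finally show ?thesis by (simp add: g_def)
  qed
  then have g: "g u = g v" for u v by (rule harmonic_imp_constant)
  have y: "y $ u = sqrt (d u) * g u" for u using deg_pos[of u] by (simp add: g_def)
  have "0 = (\<Sum>u\<in>UNIV. d u * g u)"
    using assms(2) by (simp add: inner_vec_def root_deg_def y flip: mult.assoc)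
  \<comment> \<open>\<open>undefined\<close> is an arbitrary vertex that represents the constant
    value of \<open>g\<close>.\<close>
  also have "\<dots> = (\<Sum>u\<in>UNIV. d u) * g undefined"
    unfolding sum_distrib_right using g by (intro sum.cong) auto
  finally have "g undefined = 0" using deg_pos sum_pos[of UNIV d] by auto
  then show ?thesis using g y by (metis mult_zero_right Finite_Cartesian_Product.vec_eq_iff zero_index)
qed

lemma A_orthogonal: "inner root_deg y = 0 \<Longrightarrow> inner root_deg (A *v y) = 0"
  by (simp add: A_inner[symmetric] A_root_deg)

lemma root_deg_inner_pos: "0 < inner root_deg root_deg"
  using deg_pos[of undefined] by (auto simp: root_deg_def Finite_Cartesian_Product.vec_eq_iff inner_gt_zero_iff)

text \<open>On the orthogonal complement of \<open>root_deg\<close> the norm of \<open>A\<close> is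
  attained as \<open>\<bar>c\<bar>\<close> for an eigenvalue \<open>c\<close> of \<open>A\<close>.
  Since \<open>c\<close> differs from 1, which is \<open>mu 1\<close>, it is some
  \<open>mu i\<close> with \<open>i\<close> at least 2, and these lie between
  \<open>mu CARD('v)\<close> and \<open>mu 2\<close>.\<close>

lemma norm_A_orthogonal_le:
  assumes ev: "ordered_eigenvalues A mu"
    and gap: "max \<bar>mu 2\<bar> \<bar>mu CARD('v)\<bar> \<le> \<mu>" "\<mu> < 1" and y: "inner root_deg y = 0"
  shows "norm (A *v y) \<le> \<mu> * norm y"
proof (cases "y = 0")
  case False
  let ?H = "{y. inner root_deg y = 0}"
  have "subspace ?H" by (auto simp: subspace_def inner_add_right)
  then obtain z c where z: "inner root_deg z = 0" "z \<noteq> 0" "A *v z = c *\<^sub>R z"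
    and bound: "\<And>x. inner root_deg x = 0 \<Longrightarrow> norm (A *v x) \<le> \<bar>c\<bar> * norm x"
    using symmetric_invariant_subspace_eigenvector[of "(*v) A" ?H y] y False A_inner A_orthogonal
    by auto
  have nontop: "\<bar>mu i\<bar> \<le> \<mu>" if "i \<in> {2..CARD('v)}" for i
  proof -
    have "mu i \<le> mu 2" "mu CARD('v) \<le> mu i"
      using ev that by (auto simp: ordered_eigenvalues_def monotone_on_def)
    then show ?thesis using gap(1) by linarith
  qed
  have i_cases: "i = 1 \<or> i \<in> {2..CARD('v)}" if "i \<in> {1..CARD('v)}" for i using that by auto
  have "root_deg \<noteq> 0" using root_deg_inner_pos by auto
  \<comment> \<open>The eigenvalue 1 of \<open>root_deg\<close> occurs among the
    \<open>mu i\<close>, and all of them with \<open>i\<close> at least 2 have absolute value at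
    most \<open>\<mu> < 1\<close>.\<close>
  then have "mu 1 = 1"
    using ordered_eigenvalues_eigenvector[OF ev, of root_deg 1] A_root_deg nontop gap(2) i_cases by fastforce
  moreover have "c \<noteq> 1" using A_fixed_orthogonal_eq_0[of z] z by auto
  ultimately have "\<bar>c\<bar> \<le> \<mu>"
    using ordered_eigenvalues_eigenvector[OF ev z(2,3)] nontop i_cases by metis
  then show ?thesis using bound[OF y] by (meson mult_right_mono norm_ge_zero order_trans)
qed simp

section \<open>Powers of the normalized adjacency matrix\<close>

lemma walk_simps: "walk 0 x = x" "walk (Suc l) x = A *v walk l x"
  by (simp_all add: walk_def)

lemma walk_add: "walk l (x + y) = walk l x + walk l y"
  by (induction l) (simp_all add: walk_simps matrix_vector_right_distrib)

lemma walk_scale: "walk l (c *\<^sub>R x) = c *\<^sub>R walk l x"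
  by (induction l) (simp_all add: walk_simps matrix_vector_mult_scaleR)

lemma walk_diff: "walk l (x - y) = walk l x - walk l y"
  using walk_add[of l x "- y"] walk_scale[of l "-1" y] by simp

lemma walk_Suc': "walk (Suc l) x = walk l (A *v x)"
  by (simp add: walk_def funpow_swap1)

lemma walk_inner: "inner (walk l x) y = inner x (walk l y)"
proof (induction l arbitrary: y)
  case (Suc l)
  have "inner (walk (Suc l) x) y = inner (walk l x) (A *v y)" by (simp only: walk_simps A_inner)
  also have "\<dots> = inner x (walk (Suc l) y)" by (simp only: Suc walk_Suc')
  finally show ?case .
qed (simp add: walk_simps)

lemma walk_root_deg: "walk l root_deg = root_deg"
  by (induction l) (simp_all add: walk_simps A_root_deg)

lemma walk_orthogonal: "inner root_deg y = 0 \<Longrightarrow> inner root_deg (walk l y) = 0"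
  by (induction l) (simp_all add: walk_simps A_orthogonal)

lemma walk_axis_nonneg: "0 \<le> walk l (axis v 1) $ u"
proof (induction l arbitrary: u)
  case (Suc l)
  then show ?case
    by (simp add: walk_simps matrix_vector_mult_def sum_nonneg A_nonneg)
qed (simp add: walk_simps axis_def)

text \<open>Aggregation over the neighbours, as done by one layer, lengthens the walks by one
  step.\<close>

lemma walk_axis_Suc: "(\<Sum>w\<in>N u. A $ w $ u * walk l (axis v 1) $ w) = walk (Suc l) (axis v 1) $ u"
proof -
  have "walk (Suc l) (axis v 1) $ u = (\<Sum>w\<in>UNIV. A $ w $ u * walk l (axis v 1) $ w)"
    using A_commute by (simp add: walk_simps matrix_vector_mult_def)
  also have "\<dots> = (\<Sum>w\<in>N u. A $ w $ u * walk l (axis v 1) $ w)"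
    using E_sym by (intro sum.mono_neutral_right) (auto simp: A_nth neighbors_def)
  finally show ?thesis by simp
qed

section \<open>The Laplacian and its pseudoinverse\<close>

lemma laplacian_nth: "(laplacian E *v g) $ u = d u * g $ u - (\<Sum>v\<in>N u. g $ v)"
proof -
  have "(laplacian E *v g) $ u = (\<Sum>v\<in>UNIV. (if u = v then d u * g $ v else 0))
      - (\<Sum>v\<in>UNIV. if E u v then g $ v else 0)"
    by (auto simp: laplacian_def diag_matrix_def adjacency_def matrix_vector_mult_def left_diff_distrib
        sum_subtractf if_distrib[of "\<lambda>z. z * _"] cong: if_cong intro!: arg_cong2[of _ _ _ _ "(-)"] sum.cong)
  then show ?thesis by (simp add: neighbors_def sum.If_cases)
qed

lemma laplacian_transpose: "transpose (laplacian E) = laplacian E"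
  using E_sym by (auto simp: Finite_Cartesian_Product.vec_eq_iff Finite_Cartesian_Product.transpose_def
      laplacian_def diag_matrix_def adjacency_def)

lemma laplacian_eq_0_imp_constant:
  assumes "laplacian E *v g = 0"
  shows "g $ u = g $ v"
proof (rule harmonic_imp_constant)
  fix u show "d u * g $ u = (\<Sum>v\<in>N u. g $ v)"
    using arg_cong[OF assms, of "\<lambda>z. z $ u"] by (simp add: laplacian_nth)
qed

text \<open>With \<open>J\<close> the projection onto the constants, the pseudoinverse is \<open>(L + J)\<^sup>-\<^sup>1 - J\<close>.\<close>
lemma laplacian_pseudoinverse:
  "laplacian E ** pseudoinverse (laplacian E) ** laplacian E = laplacian E"
proof -
  let ?L = "laplacian E"
  define J :: "real^'v^'v" where "J = (\<chi> i j. 1 / real CARD('v))"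
  have J_nth: "(J *v y) $ i = (\<Sum>v\<in>UNIV. y $ v) / real CARD('v)" for y i
    by (simp add: J_def matrix_vector_mult_def sum_divide_distrib)
  have Jt: "transpose J = J"
    by (simp add: J_def Finite_Cartesian_Product.vec_eq_iff Finite_Cartesian_Product.transpose_def)
  have JJ: "J ** J = J"
    by (simp add: J_def Finite_Cartesian_Product.vec_eq_iff matrix_matrix_mult_def)
  have "?L *v (J *v y) = 0" for y
    by (simp add: Finite_Cartesian_Product.vec_eq_iff laplacian_nth J_nth vertex_degree_def)
  then have LJ: "?L ** J = 0"
    by (simp add: matrix_eq matrix_vector_mul_assoc)
  have JL: "J ** ?L = 0"
    using arg_cong[OF LJ, of transpose]
    by (simp add: matrix_transpose_mul Jt laplacian_transpose)
      (simp add: Finite_Cartesian_Product.vec_eq_iff Finite_Cartesian_Product.transpose_def)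
  \<comment> \<open>Applying \<open>J\<close> to the equation removes \<open>?L\<close> and gives
    \<open>J *v y = 0\<close>. Then \<open>y\<close> is in the kernel of \<open>?L\<close>, so it is
    constant and equals its mean, which is 0.\<close>
  have "y = 0" if y: "(?L + J) *v y = 0" for y
  proof -
    have "J *v ((?L + J) *v y) = J *v y"
      by (simp add: matrix_vector_mul_assoc matrix_add_ldistrib JL JJ)
    then have Jy: "J *v y = 0" using y by simp
    then have "?L *v y = 0" using y by (simp add: matrix_vector_mult_add_rdistrib)
    then have c: "y $ v = y $ u" for u v by (rule laplacian_eq_0_imp_constant)
    have "y $ u = (J *v y) $ u" for u
    proof -
      have "(\<Sum>v\<in>UNIV. y $ v) = (\<Sum>v\<in>(UNIV :: 'v set). y $ u)" by (intro sum.cong refl c)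
      then show ?thesis by (simp add: J_nth)
    qed
    then show "y = 0" using Jy by (simp add: Finite_Cartesian_Product.vec_eq_iff)
  qed
  then obtain B where B: "B ** (?L + J) = Finite_Cartesian_Product.mat 1"
    using matrix_left_invertible_ker[of "?L + J"] by blast
  then have B': "(?L + J) ** B = Finite_Cartesian_Product.mat 1"
    by (simp add: matrix_left_right_inverse)
  have "(?L + J) ** J = J" by (simp add: matrix_add_rdistrib LJ JJ)
  then have BJ: "B ** J = J" by (metis B matrix_mul_assoc matrix_mul_lid)
  have "J ** (?L + J) = J" by (simp add: matrix_add_ldistrib JL JJ)
  then have JB: "J ** B = J" by (metis B' matrix_mul_assoc matrix_mul_rid)
  define X where "X = B - J"
  \<comment> \<open>Because \<open>B\<close> fixes the range of \<open>J\<close>, both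
    \<open>?L ** X\<close> and \<open>X ** ?L\<close> are the symmetric projection
    \<open>mat 1 - J\<close>. With \<open>J ** ?L = 0\<close> and \<open>J ** X = 0\<close> all four
    Penrose equations follow.\<close>
  have LX: "?L ** X = Finite_Cartesian_Product.mat 1 - J"
  proof -
    have "?L ** B + J = Finite_Cartesian_Product.mat 1" using B' by (simp add: matrix_add_rdistrib JB)
    moreover have "?L ** X + ?L ** J = ?L ** B" by (simp add: X_def flip: matrix_add_ldistrib)
    ultimately show ?thesis by (simp add: LJ eq_diff_eq)
  qed
  have XL: "X ** ?L = Finite_Cartesian_Product.mat 1 - J"
  proof -
    have "B ** ?L + J = Finite_Cartesian_Product.mat 1" using B by (simp add: matrix_add_ldistrib BJ)
    moreover have "X ** ?L + J ** ?L = B ** ?L" by (simp add: X_def flip: matrix_add_rdistrib)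
    ultimately show ?thesis by (simp add: JL eq_diff_eq)
  qed
  have JX: "J ** X = 0"
  proof -
    have "J ** X + J ** J = J ** B" by (simp add: X_def flip: matrix_add_ldistrib)
    then show ?thesis by (simp add: JJ JB)
  qed
  have sub: "(Finite_Cartesian_Product.mat 1 - J) ** Y = Y - J ** Y" for Y :: "real^'v^'v"
  proof -
    have "(Finite_Cartesian_Product.mat 1 - J) ** Y + J ** Y = Y" by (simp flip: matrix_add_rdistrib)
    then show ?thesis by (simp add: eq_diff_eq)
  qed
  have t: "transpose (Finite_Cartesian_Product.mat 1 - J) = Finite_Cartesian_Product.mat 1 - J"
    by (auto simp: J_def Finite_Cartesian_Product.mat_def Finite_Cartesian_Product.vec_eq_iff
        Finite_Cartesian_Product.transpose_def)
  have "?L ** X ** ?L = ?L" "X ** ?L ** X = X"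
    by (simp_all add: LX XL sub JL JX)
  moreover from this have "pseudoinverse ?L = X"
    by (intro pseudoinverse_eqI) (simp_all add: LX XL t)
  ultimately show ?thesis by simp
qed

text \<open>Any potential \<open>g\<close> for a unit current from \<open>u\<close> to
  \<open>v\<close> will do, since by symmetry of the Laplacian the pseudoinverse appears only as
  \<open>L L^+ L = L\<close>.\<close>

lemma effective_resistance_eq_inner:
  assumes "laplacian E *v g = axis u 1 - axis v 1"
  shows "effective_resistance E u v = inner g (axis u 1 - axis v 1)"
proof -
  let ?L = "laplacian E" and ?X = "pseudoinverse (laplacian E)"
  have "effective_resistance E u v = inner (?L *v g) (?X *v (?L *v g))"
    by (simp add: effective_resistance_def assms)
  also have "\<dots> = inner g (?L *v (?X *v (?L *v g)))"
    by (metis dot_lmul_matrix transpose_matrix_vector laplacian_transpose)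
  also have "\<dots> = inner g (?L *v g)"
    by (simp add: matrix_vector_mul_assoc matrix_mul_assoc laplacian_pseudoinverse)
  finally show ?thesis by (simp add: assms)
qed

section \<open>From the spectral gap to the resistance of a pair\<close>

lemma norm_walk_orthogonal_le:
  assumes gap: "\<And>y. inner root_deg y = 0 \<Longrightarrow> norm (A *v y) \<le> \<mu> * norm y" and "0 \<le> \<mu>"
    and y: "inner root_deg y = 0"
  shows "norm (walk l y) \<le> \<mu> ^ l * norm y"
proof (induction l)
  case (Suc l)
  have "norm (walk (Suc l) y) \<le> \<mu> * norm (walk l y)"
    unfolding walk_simps by (intro gap walk_orthogonal y)
  also have "\<dots> \<le> \<mu> * (\<mu> ^ l * norm y)" using Suc assms(2) by (rule mult_left_mono)
  finally show ?case by (simp add: mult.assoc)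
qed (simp add: walk_simps)

text \<open>The component of \<open>y\<close> along \<open>root_deg\<close> is fixed and the
  orthogonal rest contracts, so Pythagoras applies. This bounds the diagonal entries of powers of
  \<open>A\<close> by 1.\<close>

lemma norm_walk_le:
  assumes gap: "\<And>y. inner root_deg y = 0 \<Longrightarrow> norm (A *v y) \<le> \<mu> * norm y" and \<mu>: "0 \<le> \<mu>" "\<mu> \<le> 1"
  shows "norm (walk l y) \<le> norm y"
proof -
  define c where "c = inner root_deg y / inner root_deg root_deg"
  define z where "z = y - c *\<^sub>R root_deg"
  have z: "inner root_deg z = 0"
    using root_deg_inner_pos by (simp add: z_def c_def inner_diff_right)
  have orth: "(norm (c *\<^sub>R root_deg + x))\<^sup>2 = (norm (c *\<^sub>R root_deg))\<^sup>2 + (norm x)\<^sup>2"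
    if "inner root_deg x = 0" for x
    using that by (intro norm_add_Pythagorean) (simp add: real_inner_class.orthogonal_def)
  have "norm (walk l z) \<le> \<mu> ^ l * norm z"
    by (rule norm_walk_orthogonal_le[OF gap \<mu>(1) z])
  also have "\<dots> \<le> norm z" using \<mu> by (simp add: mult_left_le_one_le power_le_one)
  finally have "(norm (walk l z))\<^sup>2 \<le> (norm z)\<^sup>2" by (intro power_mono) auto
  moreover have y: "y = c *\<^sub>R root_deg + z" by (simp add: z_def)
  have "walk l y = c *\<^sub>R root_deg + walk l z"
    by (subst y) (simp only: walk_add walk_scale walk_root_deg)
  ultimately have "(norm (walk l y))\<^sup>2 \<le> (norm y)\<^sup>2"
    using orth[OF z] orth[OF walk_orthogonal[OF z]] y by simp
  then show ?thesis by (rule power2_le_imp_le) simp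
qed

text \<open>\<open>I - A\<close> is singular, so a rank-one term along \<open>root_deg\<close> is
  added to make it injective, hence surjective. The inner product of \<open>T z = b\<close> with
  \<open>root_deg\<close> shows that this term vanishes at the solution.\<close>

lemma solve_normalized_laplacian:
  assumes gap: "\<And>y. inner root_deg y = 0 \<Longrightarrow> norm (A *v y) \<le> \<mu> * norm y" and \<mu>: "\<mu> < 1"
    and b: "inner root_deg b = 0"
  obtains z where "z - A *v z = b" "norm z \<le> norm b / (1 - \<mu>)"
proof -
  define T where "T y = y - A *v y + inner root_deg y *\<^sub>R root_deg" for y
  have root_T: "inner root_deg (T y) = inner root_deg y * inner root_deg root_deg" for y
    by (simp add: T_def inner_add_right inner_diff_right A_inner[symmetric] A_root_deg)
  have norm_ge: "(1 - \<mu>) * norm y \<le> norm (y - A *v y)" if "inner root_deg y = 0" for y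
    using gap[OF that] norm_triangle_ineq2[of y "A *v y"] by (simp add: algebra_simps)
  have "linear T"
    unfolding T_def
    by (intro linear_compose_add linear_compose_sub linear_ident matrix_vector_mul_linear)
      (auto intro!: linearI simp: inner_add_right scaleR_left_distrib)
  moreover have "y = 0" if "T y = 0" for y
  proof -
    have "inner root_deg y = 0" using root_T[of y] that root_deg_inner_pos by simp
    then show ?thesis using norm_ge[of y] that \<mu> by (simp add: T_def mult_le_0_iff)
  qed
  ultimately have "surj T"
    by (intro linear_injective_imp_surjective) (auto simp: linear_injective_0)
  then obtain z where z: "T z = b" by (metis surjD)
  have "inner root_deg z = 0" using root_T[of z] z b root_deg_inner_pos by simp
  moreover from this have "z - A *v z = b" using z by (simp add: T_def)
  ultimately show thesis using that norm_ge[of z] \<mu> by (simp add: pos_le_divide_eq mult.commute)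
qed

lemma effective_resistance_le:
  assumes gap: "\<And>y. inner root_deg y = 0 \<Longrightarrow> norm (A *v y) \<le> \<mu> * norm y" and \<mu>: "0 \<le> \<mu>" "\<mu> < 1"
    and uv: "u \<noteq> v"
  shows "effective_resistance E u v \<le> (1 / d u + 1 / d v) * (real r + 1 + \<mu> ^ (r + 1) / (1 - \<mu>))
    - 2 * (\<Sum>l\<le>r. walk l (axis v 1) $ u) / (sqrt (d u) * sqrt (d v))"
proof -
  define p q where "p = 1 / sqrt (d u)" and "q = 1 / sqrt (d v)"
  define b where "b = p *\<^sub>R axis u 1 - q *\<^sub>R axis v (1::real)"
  have p2: "p * p = 1 / d u" and q2: "q * q = 1 / d v" using deg_pos by (auto simp: p_def q_def)
  have root: "sqrt (d w) \<noteq> 0" for w using deg_pos[of w] by simp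
  have b0: "inner root_deg b = 0"
    using root by (simp add: b_def inner_diff_right inner_axis root_deg_def p_def q_def)
  have norm_b: "(norm b)\<^sup>2 = 1 / d u + 1 / d v"
    using uv by (simp add: power2_norm_eq_inner b_def inner_diff_left inner_diff_right inner_axis_axis p2 q2)
  obtain z where z: "z - A *v z = b" and nz: "norm z \<le> norm b / (1 - \<mu>)"
    using solve_normalized_laplacian[OF gap \<mu>(2) b0] by blast
  \<comment> \<open>\<open>D^(-1/2) z\<close> is the required potential, by
    \<open>L = D^(1/2) (I - A) D^(1/2)\<close> and
    \<open>1\<^sub>u - 1\<^sub>v = D^(1/2) b\<close>.\<close>
  define g where "g = (\<chi> w. z $ w / sqrt (d w))"
  have f_nth: "(axis u 1 - axis v 1) $ w = sqrt (d w) * b $ w" for w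
    using root[of u] root[of v] uv by (auto simp: b_def axis_def p_def q_def)
  have "(laplacian E *v g) $ w = sqrt (d w) * b $ w" for w
  proof -
    have "sqrt (d w) * b $ w = sqrt (d w) * z $ w - sqrt (d w) * (A *v z) $ w"
      by (simp add: algebra_simps flip: z)
    also have "sqrt (d w) * (A *v z) $ w = (\<Sum>v\<in>N w. g $ v)"
      using root[of w] by (simp add: A_mult_nth g_def)
    also have "sqrt (d w) * z $ w = (d w / sqrt (d w)) * z $ w" by (simp add: real_div_sqrt)
    finally show ?thesis by (simp add: laplacian_nth g_def)
  qed
  then have "laplacian E *v g = axis u 1 - axis v 1"
    unfolding Finite_Cartesian_Product.vec_eq_iff f_nth by simp
  then have "effective_resistance E u v = inner g (axis u 1 - axis v 1)"
    by (rule effective_resistance_eq_inner)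
  also have "\<dots> = inner b z"
    unfolding inner_vec_def f_nth using deg_pos
    by (intro sum.cong refl) (simp add: g_def less_imp_neq[THEN not_sym])
  \<comment> \<open>A finite Neumann series: substituting \<open>b = z - A z\<close> makes the sum
    telescope.\<close>
  also have "z = (\<Sum>l\<le>r. walk l b) + walk (r + 1) z"
  proof -
    have "walk l b = walk l z - walk (Suc l) z" for l
      unfolding z[symmetric] walk_diff walk_Suc' ..
    then have "(\<Sum>l\<le>r. walk l b) = walk 0 z - walk (Suc r) z"
      using sum_telescope[of "\<lambda>l. walk l z" r] by simp
    then show ?thesis by (simp add: walk_simps(1))
  qed
  also have "inner b \<dots> = (\<Sum>l\<le>r. inner b (walk l b)) + inner (walk (r + 1) b) z"
    by (simp only: inner_add_right inner_sum_right walk_inner)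
  finally have R: "effective_resistance E u v = (\<Sum>l\<le>r. inner b (walk l b)) + inner (walk (r + 1) b) z" .
  have "inner b (walk l b) \<le> 1 / d u + 1 / d v - 2 * (walk l (axis v 1) $ u / (sqrt (d u) * sqrt (d v)))" for l
  proof -
    have diag: "walk l (axis w 1) $ w \<le> 1" for w
      using component_le_norm_cart[of "walk l (axis w 1)" w]
        norm_walk_le[OF gap \<mu>(1), of l "axis w 1"] \<mu>(2) by simp
    have comm: "walk l (axis u 1) $ v = walk l (axis v 1) $ u"
      using walk_inner[of l "axis u 1" "axis v 1"] by (simp add: inner_axis inner_axis')
    have "inner b (walk l b) = p * p * walk l (axis u 1) $ u + q * q * walk l (axis v 1) $ v
        - 2 * (p * q * walk l (axis v 1) $ u)"
      by (simp add: b_def walk_diff walk_scale inner_diff_left inner_diff_right inner_axis' comm)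
        (simp add: algebra_simps)
    moreover have "p * p * walk l (axis u 1) $ u \<le> p * p * 1" "q * q * walk l (axis v 1) $ v \<le> q * q * 1"
      by (intro mult_left_mono diag zero_le_square)+
    ultimately show ?thesis by (simp add: p2 q2) (simp add: p_def q_def)
  qed
  then have "(\<Sum>l\<le>r. inner b (walk l b))
      \<le> (\<Sum>l\<le>r. 1 / d u + 1 / d v - 2 * (walk l (axis v 1) $ u / (sqrt (d u) * sqrt (d v))))"
    by (rule sum_mono)
  also have "\<dots> = (1 / d u + 1 / d v) * (real r + 1)
      - 2 * (\<Sum>l\<le>r. walk l (axis v 1) $ u) / (sqrt (d u) * sqrt (d v))"
    by (simp add: sum_subtractf sum_divide_distrib sum_distrib_left mult.commute)
  finally have main: "(\<Sum>l\<le>r. inner b (walk l b)) \<le> \<dots>" .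
  have "inner (walk (r + 1) b) z \<le> norm (walk (r + 1) b) * norm z" by (rule norm_cauchy_schwarz)
  \<comment> \<open>The power of \<open>A\<close> has been moved from \<open>z\<close> to
    \<open>b\<close>, which is orthogonal to \<open>root_deg\<close> and therefore
    contracts.\<close>
  also have "\<dots> \<le> (\<mu> ^ (r + 1) * norm b) * (norm b / (1 - \<mu>))"
    using \<mu> by (intro mult_mono norm_walk_orthogonal_le[OF gap \<mu>(1) b0] nz) auto
  also have "\<dots> = (norm b)\<^sup>2 * (\<mu> ^ (r + 1) / (1 - \<mu>))" by (simp add: power2_eq_square)
  finally show ?thesis using R main unfolding norm_b by (simp add: distrib_left)
qed

text \<open>The resistance bound solved for the walk sum, with individual degrees replaced by the
  extreme ones.\<close>

lemma sum_walk_le: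
  assumes gap: "\<And>y. inner root_deg y = 0 \<Longrightarrow> norm (A *v y) \<le> \<mu> * norm y" and \<mu>: "0 \<le> \<mu>" "\<mu> < 1"
    and uv: "u \<noteq> v"
  shows "(\<Sum>l\<le>r. walk l (axis v 1) $ u) \<le> real (max_degree E) / 2 *
     (2 / real (min_degree E) * (real r + 1 + \<mu> ^ (r + 1) / (1 - \<mu>)) - effective_resistance E u v)"
proof -
  let ?S = "\<Sum>l\<le>r. walk l (axis v 1) $ u" and ?C = "real r + 1 + \<mu> ^ (r + 1) / (1 - \<mu>)"
  let ?Q = "2 / real (min_degree E) * ?C - effective_resistance E u v"
  have "min_degree E \<in> range (vertex_degree E)" unfolding min_degree_def by (intro Min_in) auto
  then have min_pos: "0 < real (min_degree E)" using deg_pos by auto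
  have mind: "real (min_degree E) \<le> d w" for w
    unfolding min_degree_def of_nat_le_iff by (rule Min_le) auto
  have maxd: "d w \<le> real (max_degree E)" for w
    unfolding max_degree_def of_nat_le_iff by (rule Max_ge) auto
  have C: "0 \<le> ?C" using \<mu> by simp
  have S: "0 \<le> ?S" by (intro sum_nonneg walk_axis_nonneg)
  have sq: "0 < sqrt (d u) * sqrt (d v)" using deg_pos by simp
  have "1 / d u + 1 / d v \<le> 2 / real (min_degree E)"
    using mind[of u] mind[of v] min_pos frac_le[of 1 1 "real (min_degree E)" "d u"]
      frac_le[of 1 1 "real (min_degree E)" "d v"] by simp
  then have "(1 / d u + 1 / d v) * ?C \<le> 2 / real (min_degree E) * ?C" using C by (rule mult_right_mono)
  then have SQ: "2 * ?S / (sqrt (d u) * sqrt (d v)) \<le> ?Q"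
    using effective_resistance_le[OF gap \<mu> uv, of r] by linarith
  then have "?S \<le> sqrt (d u) * sqrt (d v) / 2 * ?Q"
    using sq by (simp add: divide_le_eq mult.commute)
  also have "\<dots> \<le> real (max_degree E) / 2 * ?Q"
  proof (rule mult_right_mono)
    have "sqrt (d u) * sqrt (d v) \<le> sqrt (real (max_degree E)) * sqrt (real (max_degree E))"
      using maxd by (intro mult_mono) auto
    then show "sqrt (d u) * sqrt (d v) / 2 \<le> real (max_degree E) / 2" by simp
    \<comment> \<open>Enlarging the factor to the maximum degree needs a nonnegative bracket; it is
      one because it dominates a nonnegative walk sum.\<close>
    show "0 \<le> ?Q" using SQ S sq by (meson divide_nonneg_pos mult_nonneg_nonneg order_trans zero_le_numeral)
  qed
  finally show ?thesis .
qed

end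

section \<open>Sums over unordered pairs and the final estimate\<close>

text \<open>The ordered pairs split into those oriented as \<open>s\<close> and \<open>t\<close>
  prescribe and their reversals. By symmetry of \<open>f\<close> both halves have the same
  sum.\<close>

lemma sum_unordered_pairs:
  fixes f :: "'v::finite \<Rightarrow> 'v \<Rightarrow> real"
  assumes sym: "\<And>u v. f u v = f v u" and st: "\<And>e. card e = 2 \<Longrightarrow> e = {s e, t e}"
  shows "(\<Sum>e | card e = 2. f (s e) (t e)) = (\<Sum>(u, v) \<in> {(u, v). u \<noteq> v}. f u v) / 2"
proof -
  let ?P = "{e :: 'v set. card e = 2}"
  have ne: "s e \<noteq> t e" if "card e = 2" for e
  proof -
    have "card {s e, t e} = 2" using st that by metis
    then show ?thesis by (auto simp: card_insert_if split: if_splits)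
  qed
  let ?A = "(\<lambda>e. (s e, t e)) ` ?P" and ?B = "(\<lambda>e. (t e, s e)) ` ?P"
  have inj: "inj_on (\<lambda>e. (s e, t e)) ?P" "inj_on (\<lambda>e. (t e, s e)) ?P"
    using st by (auto intro!: inj_onI) (metis prod.inject)+
  have "{(u, v). u \<noteq> v} \<subseteq> ?A \<union> ?B"
  proof clarify
    fix u v :: 'v assume uv: "u \<noteq> v" "(u, v) \<notin> ?B"
    then have c: "card {u, v} = 2" by simp
    then have "(u = s {u, v} \<and> v = t {u, v}) \<or> (u = t {u, v} \<and> v = s {u, v})"
      using st[OF c] by (metis doubleton_eq_iff)
    then show "(u, v) \<in> ?A" using uv(2) c by blast
  qed
  then have eq: "{(u, v). u \<noteq> v} = ?A \<union> ?B" using ne ne[THEN not_sym] by auto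
  have "?A \<inter> ?B = {}"
  proof -
    \<comment> \<open>A pair in both halves would force \<open>e = e'\<close>, hence
      \<open>s e = t e\<close>.\<close>
    have False if "card e = 2" "card e' = 2" "s e = t e'" "t e = s e'" for e e'
      using that st[of e] st[of e'] ne[of e] by (metis insert_commute)
    then show ?thesis by blast
  qed
  then have "(\<Sum>(u, v) \<in> {(u, v). u \<noteq> v}. f u v) = (\<Sum>(u, v)\<in>?A. f u v) + (\<Sum>(u, v)\<in>?B. f u v)"
    unfolding eq by (intro sum.union_disjoint) auto
  also have "\<dots> = 2 * (\<Sum>e | card e = 2. f (s e) (t e))"
    using sym by (simp add: sum.reindex[OF inj(1)] sum.reindex[OF inj(2)])
  finally show ?thesis by simp
qed

theorem corollary3p6:
  fixes E :: "'v::finite \<Rightarrow> 'v \<Rightarrow> bool"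
    and fdim mdim :: "nat \<Rightarrow> nat"
    and \<phi> :: "nat \<Rightarrow> real vec \<Rightarrow> real vec \<Rightarrow> real vec"
    and \<psi> :: "nat \<Rightarrow> real vec \<Rightarrow> real vec"
    and x :: "'v \<Rightarrow> real vec"
    and r :: nat
    and \<alpha> \<beta> \<mu> :: real
    and mu :: "nat \<Rightarrow> real"
    and s t :: "'v set \<Rightarrow> 'v"
  assumes "simple_graph E" and "connected_graph E" and "\<not> bipartite E"
    and "gnn_maps fdim mdim \<phi> \<psi>"
    and "\<forall>v. x v \<in> carrier_vec (fdim 0)"
    and "\<forall>l. \<forall>z \<in> carrier_vec (fdim l + mdim l).
           operator_norm (jacobian_mat (joint (fdim l) (mdim l) (\<phi> l)) z) \<le> \<alpha>"
    and "\<forall>l. \<forall>z \<in> carrier_vec (fdim l). max (operator_norm (jacobian_mat (\<psi> l) z)) 1 \<le> \<beta>"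
    and "ordered_eigenvalues (normalized_adjacency E) mu"
    and "max \<bar>mu 2\<bar> \<bar>mu CARD('v)\<bar> \<le> \<mu>" and "\<mu> < 1"
    and "\<forall>e. card e = 2 \<longrightarrow> e = {s e, t e}"
  shows "(\<Sum>e | card e = 2. operator_norm (feature_jacobian E mdim \<phi> \<psi> x r (s e) (t e)))
     \<le> (2 * \<alpha> * \<beta>) ^ r * (real (max_degree E) / 2) *
        (real CARD('v) * (real CARD('v) - 1) / real (min_degree E) *
           (real r + 1 + \<mu> ^ (r + 1) / (1 - \<mu>))
         - total_resistance E)"
proof -
  \<comment> \<open>In a graph without edges every vertex set is trivially a bipartition.\<close>
  have "\<exists>u v. E u v"
    using assms(3) unfolding bipartite_def by blast
  then interpret connected_simple_graph E
    using assms(1,2) by unfold_locales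
  have \<mu>: "0 \<le> \<mu>" using assms(9) by linarith
  note gap = norm_A_orthogonal_le[OF assms(8,9,10)]
  have \<alpha>: "0 \<le> \<alpha>"
    using assms(6) operator_norm_nonneg zero_carrier_vec by (meson order_trans)
  have \<beta>: "0 \<le> \<beta>" and \<psi>: "\<And>l z. z \<in> carrier_vec (fdim l) \<Longrightarrow> operator_norm (jacobian_mat (\<psi> l) z) \<le> \<beta>"
    using assms(7) zero_carrier_vec[of "fdim 0"] by fastforce+
  let ?k = "(2 * \<alpha> * \<beta>) ^ r"
  let ?C = "real r + 1 + \<mu> ^ (r + 1) / (1 - \<mu>)"
  let ?n = "real CARD('v)"
  let ?D = "real (max_degree E) / 2"
  let ?m = "real (min_degree E)"
  have k: "0 \<le> ?k" using \<alpha> \<beta> by simp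
  have jacobian: "operator_norm (feature_jacobian E mdim \<phi> \<psi> x r u v) \<le> ?k * (\<Sum>l\<le>r. walk l (axis v 1) $ u)" for u v
  proof -
    define S where "S l w = (\<Sum>k\<le>l. walk k (axis v 1) $ w)" for l w
    have S_nonneg: "0 \<le> S l w" for l w
      unfolding S_def by (intro sum_nonneg walk_axis_nonneg)
    \<comment> \<open>\<open>(2 * \<alpha> * \<beta>) ^ l * S l w\<close> satisfies the recursion:
      the neighbour sum produces walks of lengths 1 to \<open>l + 1\<close>, all counted in
      \<open>S (Suc l) w\<close>.\<close>
    have step: "\<alpha> * ((2 * \<alpha> * \<beta>) ^ l * S l w + \<beta> *
        (\<Sum>u\<in>neighbors E w. \<bar>normalized_adjacency E $ u $ w\<bar> * ((2 * \<alpha> * \<beta>) ^ l * S l u)))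
        \<le> (2 * \<alpha> * \<beta>) ^ Suc l * S (Suc l) w" for l w
    proof -
      let ?c = "(2 * \<alpha> * \<beta>) ^ l"
      have c: "0 \<le> ?c" using \<alpha> \<beta> by simp
      have "(\<Sum>u\<in>neighbors E w. \<bar>normalized_adjacency E $ u $ w\<bar> * (?c * S l u))
          = ?c * (\<Sum>k\<le>l. \<Sum>u\<in>neighbors E w. normalized_adjacency E $ u $ w * walk k (axis v 1) $ u)"
        unfolding S_def sum_distrib_left
        by (subst sum.swap) (simp add: A_nonneg mult.left_commute)
      also have "\<dots> = ?c * (\<Sum>k\<le>l. walk (Suc k) (axis v 1) $ w)"
        by (simp only: walk_axis_Suc)
      also have "\<dots> \<le> ?c * S (Suc l) w"
        unfolding S_def sum.atMost_Suc_shift[of _ l]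
        using walk_axis_nonneg[of 0] c by (intro mult_left_mono) simp_all
      finally have "\<beta> * (\<Sum>u\<in>neighbors E w. \<bar>normalized_adjacency E $ u $ w\<bar> * (?c * S l u))
          \<le> \<beta> * (?c * S (Suc l) w)" using \<beta> by (rule mult_left_mono)
      \<comment> \<open>The source of the factor 2: thanks to \<open>1 \<le> \<beta>\<close> the
        vertex's own term obeys the same bound as the neighbour term.\<close>
      moreover have "?c * S l w \<le> \<beta> * (?c * S (Suc l) w)"
      proof -
        have "S l w \<le> S (Suc l) w" by (simp add: S_def walk_axis_nonneg)
        then have "?c * S l w \<le> ?c * S (Suc l) w" using c by (rule mult_left_mono)
        moreover have "1 * (?c * S (Suc l) w) \<le> \<beta> * (?c * S (Suc l) w)"
          using assms(7) zero_carrier_vec[of "fdim 0"] c S_nonneg by (intro mult_right_mono) fastforce+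
        ultimately show ?thesis by simp
      qed
      ultimately have "?c * S l w + \<beta> * (\<Sum>u\<in>neighbors E w. \<bar>normalized_adjacency E $ u $ w\<bar> * (?c * S l u))
          \<le> 2 * (\<beta> * (?c * S (Suc l) w))" by linarith
      from mult_left_mono[OF this \<alpha>] show ?thesis by (simp add: mult_ac)
    qed
    have "diff_bounded (fdim 0) (fdim r) (\<lambda>z. gnn_feature E mdim \<phi> \<psi> (x(v := z)) r u) (x v)
        ((2 * \<alpha> * \<beta>) ^ r * S r u)"
      by (rule gnn_feature_diff_bounded[where C = "\<lambda>l w. (2 * \<alpha> * \<beta>) ^ l * S l w",
            OF assms(4) _ _ \<psi> _ _ step])
        (use assms(5,6) S_nonneg[of 0] in \<open>auto simp: S_def walk_simps axis_def\<close>)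
    then show ?thesis
      unfolding feature_jacobian_def S_def by (rule diff_bounded_imp_operator_norm_le)
  qed
  let ?B = "\<lambda>u v. ?k * (?D * (2 / ?m * ?C - effective_resistance E u v))"
  have ne: "s e \<noteq> t e" if "card e = 2" for e
  proof -
    have "card {s e, t e} = 2" using assms(11) that by metis
    then show ?thesis by (auto simp: card_insert_if split: if_splits)
  qed
  have "operator_norm (feature_jacobian E mdim \<phi> \<psi> x r (s e) (t e)) \<le> ?B (s e) (t e)" if "card e = 2" for e
    using jacobian mult_left_mono[OF sum_walk_le[OF gap \<mu> assms(10) ne[OF that], of r] k]
    by (rule order_trans)
  then have "(\<Sum>e | card e = 2. operator_norm (feature_jacobian E mdim \<phi> \<psi> x r (s e) (t e)))
      \<le> (\<Sum>e | card e = 2. ?B (s e) (t e))" by (intro sum_mono) simp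
  also have "\<dots> = ?k * (?D * (real (card {e :: 'v set. card e = 2}) * (2 / ?m * ?C)
      - (\<Sum>e | card e = 2. effective_resistance E (s e) (t e))))"
  proof -
    have "(\<Sum>e\<in>X. a * (b * (c - f e))) = a * (b * (real (card X) * c - sum f X))"
      for a b c :: real and f and X :: "'v set set"
      by (simp add: sum_subtractf flip: sum_distrib_left)
    then show ?thesis .
  qed
  \<comment> \<open>The Jacobian norms depend on the orientation given by \<open>s\<close> and
    \<open>t\<close>, but their bound does so only through the resistance, which is
    symmetric.\<close>
  also have "(\<Sum>e | card e = 2. effective_resistance E (s e) (t e)) = total_resistance E"
    unfolding total_resistance_def
    using assms(11) effective_resistance_commute by (intro sum_unordered_pairs) blast+
  \<comment> \<open>There are \<open>n (n - 1) / 2\<close> pairs, and the 2 cancels against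
    \<open>2 / ?m\<close>.\<close>
  also have "real (card {e :: 'v set. card e = 2}) * (2 / ?m * ?C) = ?n * (?n - 1) / ?m * ?C"
  proof -
    have "card {e :: 'v set. card e = 2} = CARD('v) choose 2"
      using n_subsets[of "UNIV :: 'v set" 2] by simp
    also have "real \<dots> = ?n * (?n - 1) / 2"
      by (simp add: choose_two real_of_nat_div)
    finally have c: "real (card {e :: 'v set. card e = 2}) = ?n * (?n - 1) / 2" .
    have "N / 2 * (2 / m * C) = N / m * C" for N m C :: real by simp
    then show ?thesis by (simp only: c)
  qed
  finally show ?thesis by (simp only: mult.assoc)
qed

end
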